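(* (a) Let $L$ be a Lie conformal algebra. For any good $\mathbb{C}[\partial]$-submodule $V$ of $L^{*c}$, the pair $(V,\delta_V)$ is a differential Lie coalgebra. In particular, $(L^0,\delta_{L^0})$ is a differential Lie coalgebra. (b) Let $L_1$ and $L_2$ be Lie conformal algebras and let $F:L_1\to L_2$ be a homomorphism of Lie conformal algebras. Then $F^*:L_2^{*c}\to L_1^{*c}$ takes good $\mathbb{C}[\partial]$-submodules of $L_2^{*c}$ to good $\mathbb{C}[\partial]$-submodules of $L_1^{*c}$. Consequently $F^*(L_2^0)\subseteq L_1^0$, so the restriction of $F^*$ to $L_2^0$ induces a map $F^0:L_2^0\to L_1^0$, and $F^0$ is a homomorphism of differential Lie coalgebras.
   Context: A Lie conformal algebra $L$ is a $\mathbb{C}[\partial]$-module with a $\mathbb{C}$-linear map $L\otimes L\to\mathbb{C}[\lambda]\otimes L$, $a\otimes b\mapsto[a_\lambda b]$, satisfying $[\partial a_\lambda b]=-\lambda[a_\lambda b]$, $[a_\lambda\partial b]=(\lambda+\partial)[a_\lambda b]$, $[a_\lambda b]=-[b_{-\lambda-\partial}\,a]$, and $[a_\lambda[b_\mu c]]=[[a_\lambda b]_{\lambda+\mu}c]+[b_\mu[a_\lambda c]]$. A homomorphism is a $\mathbb{C}[\partial]$-linear map $F$ with $F([a_\lambda b])=[F(a)_\lambda F(b)]$. The conformal dual of a $\mathbb{C}[\partial]$-module $U$ is $U^{*c}=\{f:U\to\mathbb{C}[\lambda]\mid f\ \mathbb{C}\text{-linear},\ f_\lambda(\partial u)=\lambda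 f_\lambda(u)\}$, with $\mathbb{C}[\partial]$-action $(\partial f)_\lambda=-\lambda f_\lambda$. For a $\mathbb{C}[\partial]$-homomorphism $T:M\to N$, $T^*:N^{*c}\to M^{*c}$ is $[T^*(f)]_\lambda(m)=f_\lambda(T(m))$. Tensor products are over $\mathbb{C}$, with $\partial(u\otimes v)=\partial u\otimes v+u\otimes\partial v$. A differential Lie coalgebra $(C,\delta)$ is a $\mathbb{C}[\partial]$-module $C$ with a $\mathbb{C}[\partial]$-homomorphism $\delta:C\to C\otimes C$ such that $\tau\delta=-\delta$ and $(I\otimes\delta)\delta-(\tau\otimes I)(I\otimes\delta)\delta=(\delta\otimes I)\delta$, where $\tau(a\otimes b)=b\otimes a$. A homomorphism $f:A\to B$ is a $\mathbb{C}[\partial]$-linear map with $\delta_B\circ f=(f\otimes f)\circ\delta_A$. For $f,g\in L^{*c}$ and $a,b\in L$ set $[\Phi_\mu(f\otimes g)]_\lambda(a\otimes b)=f_\mu(a)\,g_{\lambda-\mu}(b)$ (extended linearly to $L^{*c}\otimes L^{*c}$) and $[\pi_\mu(f)]_\lambda(a\otimes b)=f_\lambda([a_\mu b])\in\mathbb{C}[\lambda,\mu]$ (with $f_\lambda$ applied coefficientwise in $\mu$). The map $\Phi_\mu$ is injective on $L^{*c}\otimes L^{*c}$. A $\mathbb{C}[\partial]$-submodule $V\subseteq L^{*c}$ is good if $\pi_\mu(V)\subseteq\Phi_{-\mu}(V\otimes V)$. For good $V$, $\delta_V:V\to V\otimes V$ is the unique map with $\Phi_{-\mu}(\delta_V(f))=\pi_\mu(f)$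 for all $f\in V$; that is, writing $\delta_V(f)=\sum f_{(1)}\otimes f_{(2)}$, $f_\lambda([a_\mu b])=\sum(f_{(1)})_{-\mu}(a)\,(f_{(2)})_{\lambda+\mu}(b)$ for all $a,b\in L$. $L^0$ denotes the sum of all good $\mathbb{C}[\partial]$-submodules of $L^{*c}$, which is itself good. *)

theory Defs
  imports Complex_Main "HOL-Library.Poly_Mapping" "HOL-Library.FuncSet"
    "HOL-Computational_Algebra.Polynomial"
begin

section \<open>Modules over the polynomial ring in \<open>\<partial>\<close>\<close>

text \<open>The ring of polynomials in \<open>\<partial>\<close> over the complex numbers is rendered as the type
  \<^typ>\<open>complex poly\<close>, its variable \<open>[:0, 1:]\<close> playing the role of \<open>\<partial>\<close>.\<close>

class cd_module = ab_group_add +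
  fixes pscale :: "complex poly \<Rightarrow> 'a \<Rightarrow> 'a"
  assumes pscale_right_distrib: "pscale p (x + y) = pscale p x + pscale p y"
    and pscale_left_distrib: "pscale (p + q) x = pscale p x + pscale q x"
    and pscale_pscale: "pscale p (pscale q x) = pscale (p * q) x"
    and pscale_one: "pscale 1 x = x"

global_interpretation cd: module "pscale :: complex poly \<Rightarrow> 'a \<Rightarrow> 'a::cd_module"
  by standard (simp_all add: pscale_right_distrib pscale_left_distrib pscale_pscale pscale_one)

definition cscale :: "complex \<Rightarrow> 'a \<Rightarrow> 'a::cd_module" (infixr \<open>*\<^sub>C\<close> 75)
  where "c *\<^sub>C x = pscale [:c:] x"

definition cpartial :: "'a \<Rightarrow> 'a::cd_module" (\<open>\<partial>\<close>)
  where "\<partial> x = pscale [:0, 1:] x"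

global_interpretation cvec: vector_space "cscale :: complex \<Rightarrow> 'a \<Rightarrow> 'a::cd_module"
proof
  fix a b :: complex and x y :: 'a
  show "a *\<^sub>C (x + y) = a *\<^sub>C x + a *\<^sub>C y" by (simp add: cscale_def pscale_right_distrib)
  show "(a + b) *\<^sub>C x = a *\<^sub>C x + b *\<^sub>C x"
    by (simp add: cscale_def flip: pscale_left_distrib)
  show "a *\<^sub>C b *\<^sub>C x = (a * b) *\<^sub>C x" by (simp add: cscale_def pscale_pscale mult.commute)
  show "1 *\<^sub>C x = x" by (simp add: cscale_def pscale_one flip: one_pCons)
qed

lemma cpartial_add: "\<partial> (x + y) = \<partial> x + \<partial> y"
  by (simp add: cpartial_def pscale_right_distrib)

lemma cpartial_cscale: "\<partial> (c *\<^sub>C x) = c *\<^sub>C \<partial> x"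
  by (simp add: cpartial_def cscale_def pscale_pscale)

definition cd_hom_on :: "'a::cd_module set \<Rightarrow> 'b::cd_module set \<Rightarrow> ('a \<Rightarrow> 'b) \<Rightarrow> bool"
  where "cd_hom_on A B f \<longleftrightarrow> f \<in> A \<rightarrow> B \<and>
    (\<forall>x\<in>A. \<forall>y\<in>A. f (x + y) = f x + f y) \<and> (\<forall>p. \<forall>x\<in>A. f (pscale p x) = pscale p (f x))"


section \<open>Tensor products over the complex numbers\<close>

text \<open>The tensor product is the free complex vector space on pairs modulo the bilinearity
  relations.\<close>

definition fscale :: "complex \<Rightarrow> ('k \<Rightarrow>\<^sub>0 complex) \<Rightarrow> ('k \<Rightarrow>\<^sub>0 complex)"
  where "fscale c p = Poly_Mapping.map ((*) c) p"

lemma lookup_fscale [simp]: "Poly_Mapping.lookup (fscale c p) k = c * Poly_Mapping.lookup p k"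
  by (simp add: fscale_def map.rep_eq when_def)

global_interpretation free: vector_space "fscale :: complex \<Rightarrow> ('k \<Rightarrow>\<^sub>0 complex) \<Rightarrow> _"
  by standard (auto intro!: poly_mapping_eqI simp: lookup_add algebra_simps)

abbreviation fgen :: "'a \<Rightarrow> 'b \<Rightarrow> (('a \<times> 'b) \<Rightarrow>\<^sub>0 complex)"
  where "fgen a b \<equiv> Poly_Mapping.single (a, b) 1"

inductive_set tensor_rels :: "(('a::cd_module \<times> 'b::cd_module) \<Rightarrow>\<^sub>0 complex) set" where
  "fgen (a + a') b - fgen a b - fgen a' b \<in> tensor_rels"
| "fgen a (b + b') - fgen a b - fgen a b' \<in> tensor_rels"
| "fgen (c *\<^sub>C a) b - fscale c (fgen a b) \<in> tensor_rels"
| "fgen a (c *\<^sub>C b) - fscale c (fgen a b) \<in> tensor_rels"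

definition tensor_eq :: "(('a::cd_module \<times> 'b::cd_module) \<Rightarrow>\<^sub>0 complex) \<Rightarrow> _ \<Rightarrow> bool"
  where "tensor_eq p q \<longleftrightarrow> p - q \<in> free.span tensor_rels"

lemma tensor_eq_equivp: "equivp (tensor_eq :: (('a::cd_module \<times> 'b::cd_module) \<Rightarrow>\<^sub>0 complex) \<Rightarrow> _)"
proof (intro equivpI reflpI sympI transpI)
  fix p q r :: "('a \<times> 'b) \<Rightarrow>\<^sub>0 complex"
  show "tensor_eq p p" by (simp add: tensor_eq_def free.span_zero)
  show "tensor_eq q p" if "tensor_eq p q"
    using free.span_neg[of "p - q" tensor_rels] that by (simp add: tensor_eq_def)
  show "tensor_eq p r" if "tensor_eq p q" "tensor_eq q r"
    using free.span_add[of "p - q" tensor_rels "q - r"] that by (simp add: tensor_eq_def)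
qed

quotient_type (overloaded) ('a, 'b) tensor = "('a::cd_module \<times> 'b::cd_module) \<Rightarrow>\<^sub>0 complex" / tensor_eq
  by (rule tensor_eq_equivp)

instantiation tensor :: (cd_module, cd_module) ab_group_add
begin

lift_definition zero_tensor :: "('a, 'b) tensor" is 0 .

lift_definition plus_tensor :: "('a, 'b) tensor \<Rightarrow> ('a, 'b) tensor \<Rightarrow> ('a, 'b) tensor" is "(+)"
  subgoal for p p' q q'
    using free.span_add[of "p - p'" tensor_rels "q - q'"] by (simp add: tensor_eq_def add_diff_add)
  done

lift_definition uminus_tensor :: "('a, 'b) tensor \<Rightarrow> ('a, 'b) tensor" is uminus
  subgoal for p p'
    using free.span_neg[of "p - p'" tensor_rels] by (simp add: tensor_eq_def)
  done

lift_definition minus_tensor :: "('a, 'b) tensor \<Rightarrow> ('a, 'b) tensor \<Rightarrow> ('a, 'b) tensor" is "(-)"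
  subgoal for p p' q q'
    using free.span_diff[of "p - p'" tensor_rels "q - q'"] by (simp add: tensor_eq_def algebra_simps)
  done

instance
proof
  fix a b c :: "('a, 'b) tensor"
  note [simp] = tensor_eq_def free.span_zero
  show "a + b + c = a + (b + c)" by transfer (simp add: add.assoc)
  show "a + b = b + a" by transfer (simp add: add.commute)
  show "0 + a = a" by transfer simp
  show "- a + a = 0" by transfer simp
  show "a - b = a + - b" by transfer simp
qed

end

lift_definition tscale :: "complex \<Rightarrow> ('a::cd_module, 'b::cd_module) tensor \<Rightarrow> ('a, 'b) tensor"
  is fscale
  subgoal for c p p'
    using free.span_scale[of "p - p'" tensor_rels c]
    by (simp add: tensor_eq_def free.scale_right_diff_distrib)
  done

global_interpretation tvec: vector_space
  "tscale :: complex \<Rightarrow> ('a::cd_module, 'b::cd_module) tensor \<Rightarrow> ('a, 'b) tensor"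
proof
  fix a b :: complex and x y :: "('a, 'b) tensor"
  note [simp] = tensor_eq_def free.span_zero
  show "tscale a (x + y) = tscale a x + tscale a y"
    by transfer (simp add: free.scale_right_distrib)
  show "tscale (a + b) x = tscale a x + tscale b x"
    by transfer (simp add: free.scale_left_distrib)
  show "tscale a (tscale b x) = tscale (a * b) x" by transfer simp
  show "tscale 1 x = x" by transfer simp
qed

lift_definition pure :: "'a::cd_module \<Rightarrow> 'b::cd_module \<Rightarrow> ('a, 'b) tensor" (infixr \<open>\<otimes>\<close> 76)
  is fgen .

lemma pure_add_left: "(a + a') \<otimes> b = a \<otimes> b + a' \<otimes> b"
  by transfer (use free.span_base[OF tensor_rels.intros(1)] in \<open>simp add: tensor_eq_def diff_diff_eq\<close>)

lemma pure_add_right: "a \<otimes> (b + b') = a \<otimes> b + a \<otimes> b'"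
  by transfer (use free.span_base[OF tensor_rels.intros(2)] in \<open>simp add: tensor_eq_def diff_diff_eq\<close>)

lemma pure_cscale_left: "(c *\<^sub>C a) \<otimes> b = tscale c (a \<otimes> b)"
  by transfer (use free.span_base[OF tensor_rels.intros(3)] in \<open>simp add: tensor_eq_def\<close>)

lemma pure_cscale_right: "a \<otimes> (c *\<^sub>C b) = tscale c (a \<otimes> b)"
  by transfer (use free.span_base[OF tensor_rels.intros(4)] in \<open>simp add: tensor_eq_def\<close>)

lemma tensor_eq_sum_pure:
  "abs_tensor p = (\<Sum>(a, b)\<in>Poly_Mapping.keys p. tscale (Poly_Mapping.lookup p (a, b)) (a \<otimes> b))"
proof -
  have *: "abs_tensor (\<Sum>k\<in>K. f k) = (\<Sum>k\<in>K. abs_tensor (f k))" if "finite K"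
    for K :: "('a \<times> 'b) set" and f :: "_ \<Rightarrow> ('a \<times> 'b) \<Rightarrow>\<^sub>0 complex"
    using that by induction (simp_all add: zero_tensor_def flip: plus_tensor.abs_eq)
  have "p = (\<Sum>k\<in>Poly_Mapping.keys p. fscale (Poly_Mapping.lookup p k) (Poly_Mapping.single k 1))"
    by (rule poly_mapping_eqI)
      (simp add: lookup_sum lookup_single when_def in_keys_iff if_distrib cong: if_cong)
  then have "abs_tensor p = (\<Sum>k\<in>Poly_Mapping.keys p. abs_tensor (fscale (Poly_Mapping.lookup p k) (Poly_Mapping.single k 1)))"
    by (subst *[symmetric]) simp_all
  also have "\<dots> = (\<Sum>(a, b)\<in>Poly_Mapping.keys p. tscale (Poly_Mapping.lookup p (a, b)) (a \<otimes> b))"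
    by (rule sum.cong) (auto simp: tscale.abs_eq pure.abs_eq)
  finally show ?thesis .
qed

text \<open>For subspaces \<open>A\<close>, \<open>B\<close> the tensor product of \<open>A\<close> and \<open>B\<close> is identified with its (injective)
  image in the tensor product of the ambient spaces.\<close>

definition tensor_sub :: "'a::cd_module set \<Rightarrow> 'b::cd_module set \<Rightarrow> ('a, 'b) tensor set"
  where "tensor_sub A B = tvec.span {a \<otimes> b | a b. a \<in> A \<and> b \<in> B}"

text \<open>The linear map on the tensor product of \<open>A\<close> and \<open>B\<close> induced by a map \<open>h\<close> which is bilinear on
  \<open>A \<times> B\<close> (\<open>sc\<close> is the scalar multiplication of the target). The value is computed from an
  arbitrary representative \<open>\<Sum> a\<^sub>i \<otimes> b\<^sub>i\<close> with all \<open>a\<^sub>i\<close> in \<open>A\<close> and \<open>b\<^sub>i\<close> in \<open>B\<close>, so that \<open>h\<close> does not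
  matter outside of \<open>A \<times> B\<close>; see \<open>tlift_pure\<close> and \<open>tlift_linear\<close> below.\<close>

definition free_lift :: "(complex \<Rightarrow> 'v \<Rightarrow> 'v) \<Rightarrow> ('a \<Rightarrow> 'b \<Rightarrow> 'v) \<Rightarrow>
    (('a \<times> 'b) \<Rightarrow>\<^sub>0 complex) \<Rightarrow> 'v::ab_group_add"
  where "free_lift sc h p = (\<Sum>(a, b)\<in>Poly_Mapping.keys p. sc (Poly_Mapping.lookup p (a, b)) (h a b))"

definition tlift :: "'a::cd_module set \<Rightarrow> 'b::cd_module set \<Rightarrow> (complex \<Rightarrow> 'v \<Rightarrow> 'v) \<Rightarrow>
    ('a \<Rightarrow> 'b \<Rightarrow> 'v) \<Rightarrow> ('a, 'b) tensor \<Rightarrow> 'v::ab_group_add"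
  where "tlift A B sc h t = free_lift sc h (SOME p. Poly_Mapping.keys p \<subseteq> A \<times> B \<and> abs_tensor p = t)"

definition bilinear_on :: "'a::cd_module set \<Rightarrow> 'b::cd_module set \<Rightarrow> (complex \<Rightarrow> 'v \<Rightarrow> 'v) \<Rightarrow>
    ('a \<Rightarrow> 'b \<Rightarrow> 'v::ab_group_add) \<Rightarrow> bool"
  where "bilinear_on A B sc h \<longleftrightarrow>
    (\<forall>a\<in>A. \<forall>a'\<in>A. \<forall>b\<in>B. h (a + a') b = h a b + h a' b) \<and>
    (\<forall>a\<in>A. \<forall>b\<in>B. \<forall>b'\<in>B. h a (b + b') = h a b + h a b') \<and>
    (\<forall>c. \<forall>a\<in>A. \<forall>b\<in>B. h (c *\<^sub>C a) b = sc c (h a b)) \<and>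
    (\<forall>c. \<forall>a\<in>A. \<forall>b\<in>B. h a (c *\<^sub>C b) = sc c (h a b))"

lemma free_lift_linear:
  assumes "vector_space sc"
  shows "Vector_Spaces.linear fscale sc (free_lift sc h)"
proof -
  interpret vector_space sc by fact
  have expand: "free_lift sc h p = (\<Sum>(a, b)\<in>K. sc (Poly_Mapping.lookup p (a, b)) (h a b))"
    if "finite K" "Poly_Mapping.keys p \<subseteq> K" for p K
    unfolding free_lift_def using that by (intro sum.mono_neutral_left) (auto simp: in_keys_iff)
  have "free_lift sc h (p + q) = free_lift sc h p + free_lift sc h q" for p q
  proof -
    have "Poly_Mapping.keys (p + q) \<subseteq> Poly_Mapping.keys p \<union> Poly_Mapping.keys q" by (rule Poly_Mapping.keys_add)
    then show ?thesis
      by (simp add: expand[of "Poly_Mapping.keys p \<union> Poly_Mapping.keys q"] lookup_add scale_left_distrib case_prod_unfold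
          sum.distrib)
  qed
  moreover have "free_lift sc h (fscale c p) = sc c (free_lift sc h p)" for c p
  proof -
    have "Poly_Mapping.keys (fscale c p) \<subseteq> Poly_Mapping.keys p" by (auto simp: in_keys_iff)
    then show ?thesis
      by (simp add: expand[of "Poly_Mapping.keys p"] case_prod_unfold scale_sum_right)
  qed
  ultimately show ?thesis
    by (auto intro!: Vector_Spaces.linear.intro module_hom.intro module_hom_axioms.intro
        simp: module_iff_vector_space assms free.vector_space_axioms)
qed

lemma free_lift_single:
  assumes "vector_space sc"
  shows "free_lift sc h (Poly_Mapping.single (a, b) c) = sc c (h a b)"
proof -
  interpret vector_space sc by fact
  show ?thesis by (cases "c = 0") (simp_all add: free_lift_def)
qed

lemma free_lift_cong_tensor:
  assumes sc: "vector_space sc" and h: "bilinear_on UNIV UNIV sc h"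
    and eq: "abs_tensor p = abs_tensor q"
  shows "free_lift sc h p = free_lift sc h q"
proof -
  interpret fl: Vector_Spaces.linear fscale sc "free_lift sc h" by (rule free_lift_linear[OF sc])
  have rels: "free_lift sc h r = 0" if "r \<in> tensor_rels" for r
    using that
  proof cases
  qed (use h in \<open>simp_all add: bilinear_on_def fl.diff fl.scale free_lift_single[OF sc]
      vector_space.vector_space_assms(4)[OF sc]\<close>)
  have "p - q \<in> free.span tensor_rels"
    using eq by (simp add: tensor.abs_eq_iff tensor_eq_def)
  then have "free_lift sc h (p - q) = 0"
    by (induction rule: free.span_induct_alt) (simp_all add: fl.add fl.scale rels)
  then show ?thesis by (simp add: fl.diff)
qed

lemma cvec_projection:
  assumes "cvec.subspace (A :: 'a::cd_module set)"
  shows "\<exists>P. range P \<subseteq> A \<and> Vector_Spaces.linear cscale cscale P \<and> (\<forall>a\<in>A. P a = a)"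
proof -
  interpret vector_space_pair "cscale :: _ \<Rightarrow> 'a \<Rightarrow> 'a" "cscale :: _ \<Rightarrow> 'a \<Rightarrow> 'a" ..
  have "Vector_Spaces.linear cscale cscale (id :: 'a \<Rightarrow> 'a)" by (rule cvec.linear_id)
  from linear_exists_left_inverse_on[OF this assms] show ?thesis by (simp add: id_def)
qed

lemma tensor_sub_rep:
  assumes A: "cvec.subspace A"
  assumes "t \<in> tensor_sub A B"
  shows "\<exists>p. Poly_Mapping.keys p \<subseteq> A \<times> B \<and> abs_tensor p = t"
  using assms(2) unfolding tensor_sub_def
proof (induction rule: tvec.span_induct_alt)
  case base
  show ?case by (rule exI[of _ 0]) (simp add: zero_tensor_def)
next
  case (step c x y)
  then obtain a b p where ab: "x = a \<otimes> b" "a \<in> A" "b \<in> B" "Poly_Mapping.keys p \<subseteq> A \<times> B" "abs_tensor p = y"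
    by blast
  have "Poly_Mapping.keys (fscale c (fgen a b) + p) \<subseteq> Poly_Mapping.keys (fscale c (fgen a b)) \<union> Poly_Mapping.keys p"
    by (rule Poly_Mapping.keys_add)
  also have "\<dots> \<subseteq> A \<times> B" using ab by (auto simp: in_keys_iff lookup_single when_def split: if_splits)
  finally show ?case
    using ab by (intro exI[of _ "fscale c (fgen a b) + p"])
      (simp add: plus_tensor.abs_eq[symmetric] tscale.abs_eq[symmetric] pure.abs_eq)
qed

lemma tlift_eq_free_lift:
  assumes sc: "vector_space sc" and h: "bilinear_on A B sc h"
    and A: "cvec.subspace A" and B: "cvec.subspace B"
    and p: "Poly_Mapping.keys p \<subseteq> A \<times> B" "abs_tensor p = t"
  shows "tlift A B sc h t = free_lift sc h p"
proof -
  obtain P where P: "range P \<subseteq> A \<and> Vector_Spaces.linear cscale cscale P \<and> (\<forall>a\<in>A. P a = a)"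
    using cvec_projection[OF A] ..
  obtain Q where Q: "range Q \<subseteq> B \<and> Vector_Spaces.linear cscale cscale Q \<and> (\<forall>b\<in>B. Q b = b)"
    using cvec_projection[OF B] ..
  interpret P: Vector_Spaces.linear cscale cscale P using P by simp
  interpret Q: Vector_Spaces.linear cscale cscale Q using Q by simp
  define h' where "h' = (\<lambda>a b. h (P a) (Q b))"
  have mem: "P a \<in> A" "Q b \<in> B" for a b using P Q by auto
  have h': "bilinear_on UNIV UNIV sc h'"
    using h mem by (simp add: bilinear_on_def h'_def P.add P.scale Q.add Q.scale)
  have eq: "free_lift sc h q = free_lift sc h' q" if "Poly_Mapping.keys q \<subseteq> A \<times> B" for q
    unfolding free_lift_def using that P Q by (intro sum.cong) (auto simp: h'_def)
  define q where "q = (SOME p. Poly_Mapping.keys p \<subseteq> A \<times> B \<and> abs_tensor p = t)"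
  have q: "Poly_Mapping.keys q \<subseteq> A \<times> B \<and> abs_tensor q = t"
    unfolding q_def by (rule someI[of _ p]) (simp add: p)
  have "free_lift sc h' q = free_lift sc h' p"
    using q p by (intro free_lift_cong_tensor[OF sc h']) simp
  with q p show ?thesis by (simp add: tlift_def eq flip: q_def)
qed

lemma tlift_pure:
  assumes sc: "vector_space sc" and h: "bilinear_on A B sc h"
    and A: "cvec.subspace A" and B: "cvec.subspace B" and "a \<in> A" "b \<in> B"
  shows "tlift A B sc h (a \<otimes> b) = h a b"
proof -
  interpret vector_space sc by fact
  have "tlift A B sc h (a \<otimes> b) = free_lift sc h (fgen a b)"
    using assms(5,6) by (intro tlift_eq_free_lift assms) (auto simp: pure.abs_eq)
  then show ?thesis by (simp add: free_lift_single[OF sc])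
qed

lemma tlift_linear:
  assumes sc: "vector_space sc" and h: "bilinear_on A B sc h"
    and A: "cvec.subspace A" and B: "cvec.subspace B"
    and t: "t \<in> tensor_sub A B" and u: "u \<in> tensor_sub A B"
  shows "tlift A B sc h (t + u) = tlift A B sc h t + tlift A B sc h u"
    and "tlift A B sc h (tscale c t) = sc c (tlift A B sc h t)"
proof -
  interpret fl: Vector_Spaces.linear fscale sc "free_lift sc h" by (rule free_lift_linear[OF sc])
  note * = tlift_eq_free_lift[OF sc h A B]
  obtain p where p: "Poly_Mapping.keys p \<subseteq> A \<times> B" "abs_tensor p = t" using tensor_sub_rep[OF A t] by blast
  obtain q where q: "Poly_Mapping.keys q \<subseteq> A \<times> B" "abs_tensor q = u" using tensor_sub_rep[OF A u] by blast
  have "Poly_Mapping.keys (p + q) \<subseteq> A \<times> B" using Poly_Mapping.keys_add[of p q] p q by blast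
  moreover have "abs_tensor (p + q) = t + u" using p q by (simp add: plus_tensor.abs_eq[symmetric])
  ultimately show "tlift A B sc h (t + u) = tlift A B sc h t + tlift A B sc h u"
    by (simp add: *[OF p] *[OF q] * fl.add)
  have "Poly_Mapping.keys (fscale c p) \<subseteq> A \<times> B" using p by (auto simp: in_keys_iff)
  moreover have "abs_tensor (fscale c p) = tscale c t" using p by (simp add: tscale.abs_eq[symmetric])
  ultimately show "tlift A B sc h (tscale c t) = sc c (tlift A B sc h t)"
    by (simp add: *[OF p] * fl.scale)
qed

lemma tensor_sub_UNIV [simp]: "t \<in> tensor_sub UNIV UNIV"
proof (induction t rule: tensor.abs_induct)
  case (1 p)
  show ?case unfolding tensor_eq_sum_pure tensor_sub_def
    by (auto intro!: tvec.span_sum tvec.span_scale intro: tvec.span_base)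
qed

lemma tlift_UNIV:
  assumes sc: "vector_space sc" and h: "bilinear_on UNIV UNIV sc h"
  shows "tlift UNIV UNIV sc h (a \<otimes> b) = h a b"
    and "tlift UNIV UNIV sc h (t + u) = tlift UNIV UNIV sc h t + tlift UNIV UNIV sc h u"
    and "tlift UNIV UNIV sc h (tscale c t) = sc c (tlift UNIV UNIV sc h t)"
  using tlift_pure[OF assms] tlift_linear[OF assms] by simp_all

definition tensor_partial :: "('a::cd_module, 'b::cd_module) tensor \<Rightarrow> ('a, 'b) tensor"
  where "tensor_partial = tlift UNIV UNIV tscale (\<lambda>u v. \<partial> u \<otimes> v + u \<otimes> \<partial> v)"

lemma tensor_partial:
  fixes u :: "'a::cd_module" and v :: "'b::cd_module" and s t :: "('a, 'b) tensor"
  shows "tensor_partial (u \<otimes> v) = \<partial> u \<otimes> v + u \<otimes> \<partial> v"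
  "tensor_partial (t + s) = tensor_partial t + tensor_partial s"
  "tensor_partial (tscale c t) = tscale c (tensor_partial t)"
proof -
  have "bilinear_on UNIV UNIV tscale (\<lambda>(u::'a) (v::'b). \<partial> u \<otimes> v + u \<otimes> \<partial> v)"
    by (simp add: bilinear_on_def cpartial_add cpartial_cscale pure_add_left pure_add_right
        pure_cscale_left pure_cscale_right tvec.scale_right_distrib)
  note * = tlift_UNIV[OF tvec.vector_space_axioms this, folded tensor_partial_def]
  show "tensor_partial (u \<otimes> v) = \<partial> u \<otimes> v + u \<otimes> \<partial> v"
    "tensor_partial (t + s) = tensor_partial t + tensor_partial s"
    "tensor_partial (tscale c t) = tscale c (tensor_partial t)"
    by (rule *)+
qed

lemma tensor_partial_zero [simp]: "tensor_partial 0 = 0"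
  using tensor_partial(2)[of 0 0] by simp

instantiation tensor :: (cd_module, cd_module) cd_module
begin

definition pscale_tensor :: "complex poly \<Rightarrow> ('a, 'b) tensor \<Rightarrow> ('a, 'b) tensor"
  where "pscale p t = (\<Sum>i\<le>degree p. tscale (coeff p i) ((tensor_partial ^^ i) t))"

lemma pscale_tensor_0: "pscale 0 (t :: ('a, 'b) tensor) = 0"
  by (simp add: pscale_tensor_def)

lemma pscale_tensor_pCons:
  "pscale (pCons a p) (t :: ('a, 'b) tensor) = tscale a t + tensor_partial (pscale p t)"
proof -
  have sum: "tensor_partial (\<Sum>i\<in>I. f i) = (\<Sum>i\<in>I. tensor_partial (f i))"
    for I :: "nat set" and f :: "nat \<Rightarrow> ('a, 'b) tensor"
    by (induction I rule: infinite_finite_induct) (simp_all add: tensor_partial)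
  show ?thesis
    by (cases "p = 0")
      (simp_all add: pscale_tensor_def sum.atMost_Suc_shift sum tensor_partial del: sum.atMost_Suc)
qed

instance
proof
  fix p q :: "complex poly" and x y :: "('a, 'b) tensor"
  note [simp] = pscale_tensor_0 pscale_tensor_pCons tensor_partial
    tvec.scale_right_distrib tvec.scale_left_distrib
  show "pscale p (x + y) = pscale p x + pscale p y"
    by (induction p) simp_all
  have add: "pscale (p + q) x = pscale p x + pscale q x" for p q
    by (induction p q rule: poly_induct2) simp_all
  then show "pscale (p + q) x = pscale p x + pscale q x" .
  have smult: "pscale (smult c p) x = tscale c (pscale p x)" for c p
    by (induction p) simp_all
  show "pscale p (pscale q x) = pscale (p * q) x"
    by (induction p) (simp_all add: add smult)
  show "pscale 1 x = x"
    by (simp add: one_pCons)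
qed

end

lemma cscale_tensor [simp]: "c *\<^sub>C t = tscale c t"
  by (simp add: cscale_def pscale_tensor_def)

lemma cpartial_tensor: "\<partial> (u \<otimes> v) = \<partial> u \<otimes> v + u \<otimes> \<partial> v"
  by (simp add: cpartial_def[of "u \<otimes> v"] pscale_tensor_def tensor_partial)

definition tmap :: "'a::cd_module set \<Rightarrow> 'b::cd_module set \<Rightarrow> ('a \<Rightarrow> 'c::cd_module) \<Rightarrow>
    ('b \<Rightarrow> 'd::cd_module) \<Rightarrow> ('a, 'b) tensor \<Rightarrow> ('c, 'd) tensor"
  where "tmap A B f g = tlift A B cscale (\<lambda>a b. f a \<otimes> g b)"

definition tswap :: "('a::cd_module, 'b::cd_module) tensor \<Rightarrow> ('b, 'a) tensor"
  where "tswap = tlift UNIV UNIV cscale (\<lambda>a b. b \<otimes> a)"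

definition tassoc :: "('a::cd_module, ('b::cd_module, 'c::cd_module) tensor) tensor \<Rightarrow>
    (('a, 'b) tensor, 'c) tensor"
  where "tassoc = tlift UNIV UNIV cscale (\<lambda>a. tlift UNIV UNIV cscale (\<lambda>b c. (a \<otimes> b) \<otimes> c))"


section \<open>Differential Lie coalgebras\<close>

text \<open>The coalgebra lives on a submodule \<open>C\<close> of the ambient module; only the restriction of \<open>\<delta>\<close> to
  \<open>C\<close> is relevant. The two ways of bracketing a triple tensor product are identified by \<^const>\<open>tassoc\<close>.\<close>

definition diff_lie_coalgebra :: "'c::cd_module set \<Rightarrow> ('c \<Rightarrow> ('c, 'c) tensor) \<Rightarrow> bool"
  where "diff_lie_coalgebra C \<delta> \<longleftrightarrow>
    cd.subspace C \<and> cd_hom_on C (tensor_sub C C) \<delta> \<and>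
    (\<forall>x\<in>C. tswap (\<delta> x) = - \<delta> x) \<and>
    (\<forall>x\<in>C. let y = tassoc (tmap C C id \<delta> (\<delta> x)) in
       y - tmap UNIV UNIV tswap id y = tmap C C \<delta> id (\<delta> x))"

definition diff_lie_coalgebra_hom :: "'a::cd_module set \<Rightarrow> ('a \<Rightarrow> ('a, 'a) tensor) \<Rightarrow>
    'b::cd_module set \<Rightarrow> ('b \<Rightarrow> ('b, 'b) tensor) \<Rightarrow> ('a \<Rightarrow> 'b) \<Rightarrow> bool"
  where "diff_lie_coalgebra_hom A \<delta>A B \<delta>B f \<longleftrightarrow>
    cd_hom_on A B f \<and> (\<forall>x\<in>A. \<delta>B (f x) = tmap A A f f (\<delta>A x))"


section \<open>Lie conformal algebras\<close>

text \<open>For a module \<open>M\<close> over \<open>R\<close>, the type \<open>'m poly\<close> represents the polynomials with coefficients in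
  \<open>M\<close>, and \<open>poly_act s\<close> is its structure as a module over the polynomial ring of \<open>R\<close>.\<close>

definition poly_act :: "('r::comm_ring_1 \<Rightarrow> 'm \<Rightarrow> 'm) \<Rightarrow> 'r poly \<Rightarrow> 'm poly \<Rightarrow> 'm::ab_group_add poly"
  where "poly_act s q p = (\<Sum>i\<le>degree q. \<Sum>j\<le>degree p. monom (s (coeff q i) (coeff p j)) (i + j))"

text \<open>\<open>psubst act q \<phi> p\<close> replaces the variable of \<open>p\<close> by the ring element \<open>q\<close>, which acts from the left
  through \<open>act\<close>, and every coefficient \<open>x\<close> of \<open>p\<close> by \<open>\<phi> x\<close>.\<close>

definition psubst :: "('r::comm_ring_1 \<Rightarrow> 'm \<Rightarrow> 'm) \<Rightarrow> 'r \<Rightarrow> ('l::zero \<Rightarrow> 'm) \<Rightarrow> 'l poly \<Rightarrow> 'm::ab_group_add"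
  where "psubst act q \<phi> p = (\<Sum>i\<le>degree p. act (q ^ i) (\<phi> (coeff p i)))"

text \<open>Polynomials in one variable \<open>\<lambda>\<close>: \<^typ>\<open>complex poly poly\<close> is the ring of polynomials in
  \<open>\<lambda>\<close> over the polynomials in \<open>\<partial>\<close>, acting on \<open>'l poly\<close>.\<close>

abbreviation act1 :: "complex poly poly \<Rightarrow> 'l poly \<Rightarrow> 'l::cd_module poly"
  where "act1 \<equiv> poly_act pscale"

abbreviation lambda1 :: "complex poly poly"
  where "lambda1 \<equiv> [:0, 1:]"

abbreviation partial1 :: "complex poly poly"
  where "partial1 \<equiv> [:[:0, 1:]:]"

text \<open>Polynomials in two variables \<open>\<lambda>\<close> (inner) and \<open>\<mu>\<close> (outer), with arbitrary coefficients.\<close>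

abbreviation act2 :: "complex poly poly poly \<Rightarrow> 'l poly poly \<Rightarrow> 'l::cd_module poly poly"
  where "act2 \<equiv> poly_act (poly_act pscale)"

abbreviation lambda2 :: "'r::comm_ring_1 poly poly"
  where "lambda2 \<equiv> [:[:0, 1:]:]"

abbreviation mu2 :: "'r::comm_ring_1 poly poly"
  where "mu2 \<equiv> [:0, 1:]"

text \<open>\<open>br a b\<close> is the polynomial \<open>[a\<^sub>\<lambda> b]\<close>, and \<open>bracket_at br q a b\<close> is \<open>[a\<^sub>q b]\<close>, a polynomial in \<open>\<lambda>\<close>
  and \<open>\<mu>\<close>.\<close>

definition bracket_at :: "('l \<Rightarrow> 'l \<Rightarrow> 'l poly) \<Rightarrow> complex poly poly poly \<Rightarrow> 'l \<Rightarrow> 'l \<Rightarrow> 'l::cd_module poly poly"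
  where "bracket_at br q a b = psubst act2 q (\<lambda>x. [:[:x:]:]) (br a b)"

locale lie_conformal_algebra =
  fixes br :: "'l::cd_module \<Rightarrow> 'l \<Rightarrow> 'l poly"
  assumes add_left: "\<And>a a' b. br (a + a') b = br a b + br a' b"
    and add_right: "\<And>a b b'. br a (b + b') = br a b + br a b'"
    and scale_left: "\<And>c a b. br (c *\<^sub>C a) b = map_poly (cscale c) (br a b)"
    and scale_right: "\<And>c a b. br a (c *\<^sub>C b) = map_poly (cscale c) (br a b)"
    and partial_left: "\<And>a b. br (\<partial> a) b = act1 (- lambda1) (br a b)"
    and partial_right: "\<And>a b. br a (\<partial> b) = act1 (lambda1 + partial1) (br a b)"
    and skew: "\<And>a b. br a b = - psubst act1 (- lambda1 - partial1) (\<lambda>x. [:x:]) (br b a)"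
    and jacobi: "\<And>a b c. psubst act2 mu2 (\<lambda>x. bracket_at br lambda2 a x) (br b c) =
      psubst act2 lambda2 (\<lambda>x. bracket_at br (lambda2 + mu2) x c) (br a b) +
      psubst act2 lambda2 (\<lambda>x. bracket_at br mu2 b x) (br a c)"

definition lie_conformal_hom :: "('l \<Rightarrow> 'l \<Rightarrow> 'l poly) \<Rightarrow> ('m \<Rightarrow> 'm \<Rightarrow> 'm poly) \<Rightarrow>
    ('l::cd_module \<Rightarrow> 'm::cd_module) \<Rightarrow> bool"
  where "lie_conformal_hom br1 br2 F \<longleftrightarrow>
    module_hom pscale pscale F \<and> (\<forall>a b. map_poly F (br1 a b) = br2 (F a) (F b))"


section \<open>The conformal dual\<close>

lemma vector_space_smult: "vector_space (smult :: complex \<Rightarrow> complex poly \<Rightarrow> complex poly)"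
  by unfold_locales (simp_all add: smult_add_right smult_add_left)

lemma linear_cscale_smult_iff:
  "Vector_Spaces.linear cscale smult (f :: 'u::cd_module \<Rightarrow> complex poly) \<longleftrightarrow>
    (\<forall>x y. f (x + y) = f x + f y) \<and> (\<forall>c x. f (c *\<^sub>C x) = smult c (f x))"
  by (simp add: Vector_Spaces.linear_iff vector_space_smult cvec.vector_space_axioms)

typedef (overloaded) 'u cdual =
  "{f :: 'u::cd_module \<Rightarrow> complex poly.
     Vector_Spaces.linear cscale smult f \<and> (\<forall>u. f (\<partial> u) = [:0, 1:] * f u)}"
  morphisms cdual_apply Abs_cdual
proof (rule exI[of _ "\<lambda>_. 0"])
  show "(\<lambda>_. 0) \<in> {f :: 'u \<Rightarrow> complex poly.
      Vector_Spaces.linear cscale smult f \<and> (\<forall>u. f (\<partial> u) = [:0, 1:] * f u)}"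
    by (simp add: linear_cscale_smult_iff)
qed

setup_lifting type_definition_cdual

instantiation cdual :: (cd_module) cd_module
begin

lift_definition zero_cdual :: "'a cdual" is "\<lambda>_. 0"
  by (simp add: linear_cscale_smult_iff)

lift_definition plus_cdual :: "'a cdual \<Rightarrow> 'a cdual \<Rightarrow> 'a cdual" is "\<lambda>f g u. f u + g u"
  by (simp add: linear_cscale_smult_iff algebra_simps smult_add_right)

lift_definition uminus_cdual :: "'a cdual \<Rightarrow> 'a cdual" is "\<lambda>f u. - f u"
  by (simp add: linear_cscale_smult_iff)

lift_definition minus_cdual :: "'a cdual \<Rightarrow> 'a cdual \<Rightarrow> 'a cdual" is "\<lambda>f g u. f u - g u"
  by (simp add: linear_cscale_smult_iff algebra_simps smult_diff_right)

text \<open>Since \<open>(\<partial> f)\<^sub>\<lambda> = - \<lambda> f\<^sub>\<lambda>\<close>, a polynomial \<open>p(\<partial>)\<close> acts as multiplication by \<open>p(- \<lambda>)\<close>.\<close>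

lift_definition pscale_cdual :: "complex poly \<Rightarrow> 'a cdual \<Rightarrow> 'a cdual"
  is "\<lambda>p f u. pcompose p [:0, - 1:] * f u"
  by (simp add: linear_cscale_smult_iff algebra_simps)

instance
  by standard (transfer, simp add: algebra_simps pcompose_add pcompose_mult pcompose_1; fail)+

end

lemma cpartial_cdual: "cdual_apply (\<partial> f) u = - [:0, 1:] * cdual_apply f u"
  by (simp add: cpartial_def pscale_cdual.rep_eq pcompose_pCons)

text \<open>The dual \<open>T\<^sup>*\<close> of a module homomorphism \<open>T\<close>.\<close>

definition dual_map :: "('m::cd_module \<Rightarrow> 'n::cd_module) \<Rightarrow> 'n cdual \<Rightarrow> 'm cdual"
  where "dual_map T f = Abs_cdual (\<lambda>m. cdual_apply f (T m))"

lemma cdual_apply_dual_map: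
  assumes "module_hom pscale pscale T"
  shows "cdual_apply (dual_map T f) m = cdual_apply f (T m)"
proof -
  interpret module_hom pscale pscale T by fact
  have "T (c *\<^sub>C x) = c *\<^sub>C T x" "T (\<partial> x) = \<partial> (T x)" for c x
    by (simp_all add: cscale_def cpartial_def scale)
  then show ?thesis
    unfolding dual_map_def using cdual_apply[of f]
    by (subst Abs_cdual_inverse) (simp_all add: linear_cscale_smult_iff add)
qed


section \<open>Good submodules and the maximal good submodule\<close>

text \<open>Complex polynomials in \<open>\<lambda>\<close> and \<open>\<mu>\<close> are elements of \<^typ>\<open>complex poly poly\<close>, the outer variable
  being \<open>\<mu>\<close>. \<open>cdual_at f m\<close> is \<open>f\<^sub>m\<close>: the variable of the polynomial is replaced by \<open>m\<close>.\<close>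

definition cdual_at :: "'l::cd_module cdual \<Rightarrow> complex poly poly \<Rightarrow> 'l \<Rightarrow> complex poly poly"
  where "cdual_at f m a = poly (map_poly (\<lambda>c. [:[:c:]:]) (cdual_apply f a)) m"

abbreviation cscale2 :: "complex \<Rightarrow> complex poly poly \<Rightarrow> complex poly poly"
  where "cscale2 c \<equiv> smult [:c:]"

text \<open>\<open>Phi m\<close> is \<open>\<Phi>\<^sub>m\<close>; the cases of interest are \<open>m = \<mu>\<close> and \<open>m = - \<mu>\<close>.\<close>

definition Phi :: "complex poly poly \<Rightarrow> ('l cdual, 'l cdual) tensor \<Rightarrow>
    ('l::cd_module, 'l) tensor \<Rightarrow> complex poly poly"
  where "Phi m t x = tlift UNIV UNIV cscale2
    (\<lambda>f g. tlift UNIV UNIV cscale2 (\<lambda>a b. cdual_at f m a * cdual_at g (lambda2 - m) b) x) t"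

text \<open>The map \<open>\<pi>\<^sub>\<mu>\<close>; here \<open>[a\<^sub>\<mu> b]\<close> is read as a polynomial in \<open>\<mu>\<close>, and \<open>f\<^sub>\<lambda>\<close> is applied to its
  coefficients.\<close>

definition Pi_mu :: "('l \<Rightarrow> 'l \<Rightarrow> 'l poly) \<Rightarrow> 'l cdual \<Rightarrow> ('l::cd_module, 'l) tensor \<Rightarrow> complex poly poly"
  where "Pi_mu br f = tlift UNIV UNIV cscale2 (\<lambda>a b. map_poly (cdual_apply f) (br a b))"

definition good :: "('l \<Rightarrow> 'l \<Rightarrow> 'l poly) \<Rightarrow> 'l::cd_module cdual set \<Rightarrow> bool"
  where "good br V \<longleftrightarrow> cd.subspace V \<and> Pi_mu br ` V \<subseteq> Phi (- mu2) ` tensor_sub V V"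

text \<open>The description below determines \<open>\<delta>\<^sub>V(f)\<close> uniquely for good \<open>V\<close> and \<open>f \<in> V\<close>, because
  \<open>\<Phi>\<close> is injective.\<close>

definition delta :: "('l \<Rightarrow> 'l \<Rightarrow> 'l poly) \<Rightarrow> 'l cdual set \<Rightarrow> 'l::cd_module cdual \<Rightarrow>
    ('l cdual, 'l cdual) tensor"
  where "delta br V f = (THE t. t \<in> tensor_sub V V \<and> Phi (- mu2) t = Pi_mu br f)"

text \<open>The sum \<open>L\<^sup>0\<close> of all good submodules.\<close>

definition L0 :: "('l \<Rightarrow> 'l \<Rightarrow> 'l poly) \<Rightarrow> 'l::cd_module cdual set"
  where "L0 br = cd.span (\<Union>{V. good br V})"

text \<open>The restriction \<open>F\<^sup>0\<close> of \<open>F\<^sup>*\<close> to \<open>L\<^sub>2\<^sup>0\<close>.\<close>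

definition dual_map0 :: "('m \<Rightarrow> 'm \<Rightarrow> 'm poly) \<Rightarrow> ('l::cd_module \<Rightarrow> 'm::cd_module) \<Rightarrow>
    'm cdual \<Rightarrow> 'l cdual"
  where "dual_map0 br2 F = restrict (dual_map F) (L0 br2)"

end

theory Submission
  imports Defs
begin

text \<open>Polynomial identities are tested by evaluating all variables at complex numbers. The point
  evaluations \<open>f \<mapsto> f\<^sub>x(a)\<close> separate the points of \<open>L\<^sup>*\<^sup>c\<close>, and tensor products of separating families of
  functionals are separating on tensor products. So \<open>\<delta> f\<close>, and likewise the triple tensors of the
  co-Jacobi identity, are determined by their point evaluations, where \<open>\<delta> f\<close> is given by
  \<open>(a, u), (b, v) \<mapsto> f\<^bsub>u+v\<^esub>([a\<^bsub>-u\<^esub> b])\<close>. Anticommutativity and co-Jacobi then are skew symmetry and the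
  Jacobi identity in \<open>L\<close> at complex parameters, and the compatibility with \<open>F\<^sup>*\<close> is \<open>F[a\<^bsub>-u\<^esub> b] = [F a\<^bsub>-u\<^esub> F b]\<close>.\<close>


section \<open>Functionals on tensor products\<close>

text \<open>The step also supplies membership of the tail in \<open>tensor_sub A B\<close>, because
  maps such as \<open>tmap A B f g\<close> are known to be additive only there.\<close>

lemma tensor_sub_induct [consumes 1, case_names zero step]:
  assumes "t \<in> tensor_sub A B"
    and "P 0"
    and "\<And>c a b t. a \<in> A \<Longrightarrow> b \<in> B \<Longrightarrow> t \<in> tensor_sub A B \<Longrightarrow> P t \<Longrightarrow> P (tscale c (a \<otimes> b) + t)"
  shows "P t"
proof -
  have "t \<in> tensor_sub A B \<and> P t"
    using assms(1)[unfolded tensor_sub_def]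
  proof (induction rule: tvec.span_induct_alt)
    case base
    show ?case by (simp add: assms(2) tensor_sub_def tvec.span_zero)
  next
    case (step c x y)
    then obtain a b where "x = a \<otimes> b" "a \<in> A" "b \<in> B" by blast
    then have "x \<in> tvec.span {a \<otimes> b | a b. a \<in> A \<and> b \<in> B}"
      by (blast intro: tvec.span_base)
    with step \<open>x = a \<otimes> b\<close> \<open>a \<in> A\<close> \<open>b \<in> B\<close> show ?case
      by (simp add: assms(3) tensor_sub_def tvec.span_add tvec.span_scale)
  qed
  then show ?thesis ..
qed

lemma tensor_induct [case_names zero step]:
  assumes "P 0" "\<And>c a b t. P t \<Longrightarrow> P (tscale c (a \<otimes> b) + t)"
  shows "P t"
  using tensor_sub_UNIV[of t] by (induction rule: tensor_sub_induct) (simp_all add: assms)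

lemma tensor_sub_zero [simp]: "0 \<in> tensor_sub A B"
  and tensor_sub_add: "s \<in> tensor_sub A B \<Longrightarrow> t \<in> tensor_sub A B \<Longrightarrow> s + t \<in> tensor_sub A B"
  and tensor_sub_scale: "t \<in> tensor_sub A B \<Longrightarrow> tscale c t \<in> tensor_sub A B"
  and tensor_sub_pure: "a \<in> A \<Longrightarrow> b \<in> B \<Longrightarrow> a \<otimes> b \<in> tensor_sub A B"
  by (auto simp: tensor_sub_def tvec.span_zero intro: tvec.span_add tvec.span_scale tvec.span_base)

lemma tensor_sub_mono: "A \<subseteq> A' \<Longrightarrow> B \<subseteq> B' \<Longrightarrow> tensor_sub A B \<subseteq> tensor_sub A' B'"
  unfolding tensor_sub_def by (intro tvec.span_mono) blast

lemma pure_zero_left [simp]: "0 \<otimes> b = 0"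
  using pure_add_left[of 0 0 b] by simp

lemma pure_zero_right [simp]: "a \<otimes> 0 = 0"
  using pure_add_right[of a 0 0] by simp

lemma pure_sum_right: "a \<otimes> (\<Sum>i\<in>I. f i) = (\<Sum>i\<in>I. a \<otimes> f i)"
  by (induction I rule: infinite_finite_induct) (simp_all add: pure_add_right)

section \<open>Linear functionals and separating families\<close>

definition linear_functional :: "('a::cd_module \<Rightarrow> complex) \<Rightarrow> bool"
  where "linear_functional \<phi> \<longleftrightarrow>
    (\<forall>x y. \<phi> (x + y) = \<phi> x + \<phi> y) \<and> (\<forall>c x. \<phi> (c *\<^sub>C x) = c * \<phi> x)"

lemma linear_functionalD:
  assumes "linear_functional \<phi>"
  shows "\<phi> (x + y) = \<phi> x + \<phi> y" "\<phi> (c *\<^sub>C x) = c * \<phi> x" "\<phi> 0 = 0" "\<phi> (- x) = - \<phi> x"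
    "\<phi> (x - y) = \<phi> x - \<phi> y"
proof -
  show *: "\<phi> (x + y) = \<phi> x + \<phi> y" "\<phi> (c *\<^sub>C x) = c * \<phi> x" for x y c
    using assms by (simp_all add: linear_functional_def)
  show 0: "\<phi> 0 = 0" using *(1)[of 0 0] by simp
  show neg: "\<phi> (- x) = - \<phi> x" for x using *(1)[of x "- x"] by (simp add: 0 eq_neg_iff_add_eq_0 add.commute)
  show "\<phi> (x - y) = \<phi> x - \<phi> y" using *(1)[of x "- y"] by (simp add: neg)
qed

lemma linear_functional_sum:
  assumes "linear_functional \<phi>"
  shows "\<phi> (\<Sum>i\<in>I. f i) = (\<Sum>i\<in>I. \<phi> (f i))"
  by (induction I rule: infinite_finite_induct) (simp_all add: linear_functionalD[OF assms])

lemma vector_space_complex: "vector_space ((*) :: complex \<Rightarrow> complex \<Rightarrow> complex)"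
  by unfold_locales (simp_all add: algebra_simps)

definition tensor_functional :: "('a::cd_module \<Rightarrow> complex) \<Rightarrow> ('b::cd_module \<Rightarrow> complex) \<Rightarrow>
    ('a, 'b) tensor \<Rightarrow> complex"
  where "tensor_functional \<phi> \<psi> = tlift UNIV UNIV (*) (\<lambda>a b. \<phi> a * \<psi> b)"

lemma
  assumes "linear_functional \<phi>" "linear_functional \<psi>"
  shows tensor_functional_pure: "tensor_functional \<phi> \<psi> (a \<otimes> b) = \<phi> a * \<psi> b"
    and linear_tensor_functional: "linear_functional (tensor_functional \<phi> \<psi>)"
proof -
  have "bilinear_on UNIV UNIV (*) (\<lambda>a b. \<phi> a * \<psi> b)"
    by (simp add: bilinear_on_def linear_functionalD[OF assms(1)] linear_functionalD[OF assms(2)]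
        algebra_simps)
  note * = tlift_UNIV[OF vector_space_complex this, folded tensor_functional_def]
  show "tensor_functional \<phi> \<psi> (a \<otimes> b) = \<phi> a * \<psi> b"
    by (rule *)
  show "linear_functional (tensor_functional \<phi> \<psi>)"
    by (simp add: linear_functional_def *)
qed

lemmas tensor_functional_simps =
  linear_functionalD[OF linear_tensor_functional, unfolded cscale_tensor] tensor_functional_pure

definition separating :: "('a::cd_module \<Rightarrow> complex) set \<Rightarrow> bool"
  where "separating \<Phi> \<longleftrightarrow> (\<forall>\<phi>\<in>\<Phi>. linear_functional \<phi>) \<and> (\<forall>x. (\<forall>\<phi>\<in>\<Phi>. \<phi> x = 0) \<longrightarrow> x = 0)"

lemma separatingD:
  assumes "separating \<Phi>" "\<And>\<phi>. \<phi> \<in> \<Phi> \<Longrightarrow> \<phi> x = \<phi> y"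
  shows "x = y"
proof -
  have "\<phi> (x - y) = 0" if "\<phi> \<in> \<Phi>" for \<phi>
    using assms that linear_functionalD(5)[of \<phi>] by (simp add: separating_def)
  then have "x - y = 0"
    using assms(1) unfolding separating_def by blast
  then show ?thesis by simp
qed

text \<open>Each right factor is expanded over \<open>B\<close> and the scalars are moved into the
  left factor; spanning suffices here, as no uniqueness is claimed.\<close>

lemma tensor_basis_expansion:
  fixes t :: "('a::cd_module, 'b::cd_module) tensor"
  assumes "cvec.span B = (UNIV :: 'b set)"
  shows "\<exists>I x. finite I \<and> I \<subseteq> B \<and> t = (\<Sum>b\<in>I. x b \<otimes> b)"
proof (induction t rule: tensor_induct)
  case zero
  show ?case by (intro exI[of _ "{}"]) simp
next
  case (step c a w t)
  then obtain I x where I: "finite I" "I \<subseteq> B" "t = (\<Sum>b\<in>I. x b \<otimes> b)" by blast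
  have "w \<in> cvec.span B" using assms by simp
  then obtain J r where J: "finite J" "J \<subseteq> B" "w = (\<Sum>b\<in>J. r b *\<^sub>C b)"
    unfolding cvec.span_explicit by blast
  have w: "tscale c (a \<otimes> w) = (\<Sum>b\<in>J. ((c * r b) *\<^sub>C a) \<otimes> b)"
    by (simp add: J pure_sum_right tvec.scale_sum_right pure_cscale_left pure_cscale_right)
  \<comment> \<open>The two expansions are merged over \<open>I \<union> J\<close>, each extended by
    0 outside its own index set.\<close>
  define y where "y b = (if b \<in> J then (c * r b) *\<^sub>C a else 0) + (if b \<in> I then x b else 0)" for b
  have "(\<Sum>b\<in>I \<union> J. y b \<otimes> b) =
      (\<Sum>b\<in>I \<union> J. if b \<in> J then ((c * r b) *\<^sub>C a) \<otimes> b else 0) +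
      (\<Sum>b\<in>I \<union> J. if b \<in> I then x b \<otimes> b else 0)"
    by (simp add: y_def pure_add_left sum.distrib[symmetric]) (rule sum.cong, auto)
  also have "\<dots> = tscale c (a \<otimes> w) + t"
    using I J(1) by (simp add: w sum.If_cases Int_absorb1 Int_absorb2)
  finally show ?case
    using I J by (intro exI[of _ "I \<union> J"] exI[of _ y]) simp
qed

text \<open>Write \<open>t\<close> as a sum of \<open>x b \<otimes> b\<close> over basis vectors
  \<open>b\<close>. For fixed \<open>\<phi>\<close>, every \<open>\<psi>\<close> kills the vector
  with coordinates \<open>\<phi> (x b)\<close>, so that vector is 0; independence gives
  \<open>\<phi> (x b) = 0\<close> for all \<open>\<phi>\<close>, hence
  \<open>x b = 0\<close>.\<close>

lemma separating_tensor:
  fixes \<Phi> :: "('a::cd_module \<Rightarrow> complex) set" and \<Psi> :: "('b::cd_module \<Rightarrow> complex) set"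
  assumes "separating \<Phi>" "separating \<Psi>"
  shows "separating {tensor_functional \<phi> \<psi> | \<phi> \<psi>. \<phi> \<in> \<Phi> \<and> \<psi> \<in> \<Psi>}"
  unfolding separating_def
proof (intro conjI ballI allI impI)
  have lin: "\<phi> \<in> \<Phi> \<Longrightarrow> linear_functional \<phi>" "\<psi> \<in> \<Psi> \<Longrightarrow> linear_functional \<psi>" for \<phi> \<psi>
    using assms by (auto simp: separating_def)
  show "linear_functional \<xi>" if "\<xi> \<in> {tensor_functional \<phi> \<psi> | \<phi> \<psi>. \<phi> \<in> \<Phi> \<and> \<psi> \<in> \<Psi>}" for \<xi>
    using that lin linear_tensor_functional by blast
  fix t :: "('a, 'b) tensor"
  assume t0: "\<forall>\<xi>\<in>{tensor_functional \<phi> \<psi> | \<phi> \<psi>. \<phi> \<in> \<Phi> \<and> \<psi> \<in> \<Psi>}. \<xi> t = 0"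
  obtain B :: "'b set" where B: "cvec.independent B" "cvec.span B = UNIV"
    by (metis cvec.basis_exists top.extremum_uniqueI)
  obtain I x where I: "finite I" "I \<subseteq> B" "t = (\<Sum>b\<in>I. x b \<otimes> b)"
    using tensor_basis_expansion[OF B(2)] by blast
  have x0: "\<phi> (x b) = 0" if "\<phi> \<in> \<Phi>" "b \<in> I" for \<phi> b
  proof -
    have "\<psi> (\<Sum>b\<in>I. \<phi> (x b) *\<^sub>C b) = 0" if "\<psi> \<in> \<Psi>" for \<psi>
    proof -
      have "\<psi> (\<Sum>b\<in>I. \<phi> (x b) *\<^sub>C b) = tensor_functional \<phi> \<psi> t"
        using lin \<open>\<phi> \<in> \<Phi>\<close> that by (simp add: I linear_functional_sum linear_tensor_functional
            tensor_functional_pure linear_functionalD(2))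
      then show ?thesis using t0 that \<open>\<phi> \<in> \<Phi>\<close> by auto
    qed
    then have "(\<Sum>b\<in>I. \<phi> (x b) *\<^sub>C b) = 0"
      using assms(2) by (auto simp: separating_def)
    then show ?thesis
      using B(1)[unfolded cvec.independent_explicit_module, rule_format, OF I(1,2), of "\<lambda>b. \<phi> (x b)"]
        \<open>b \<in> I\<close> by simp
  qed
  have "x b = 0" if "b \<in> I" for b
    using x0[OF _ that] assms(1) by (auto simp: separating_def)
  then show "t = 0"
    by (simp add: I)
qed

section \<open>Induced maps, swap and reassociation on tensor products\<close>

definition clinear_on :: "'a::cd_module set \<Rightarrow> ('a \<Rightarrow> 'b::cd_module) \<Rightarrow> bool"
  where "clinear_on A f \<longleftrightarrow> (\<forall>x\<in>A. \<forall>y\<in>A. f (x + y) = f x + f y) \<and> (\<forall>c. \<forall>x\<in>A. f (c *\<^sub>C x) = c *\<^sub>C f x)"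

lemma clinear_on_id: "clinear_on A id"
  by (simp add: clinear_on_def)

lemma cd_hom_on_imp_clinear_on: "cd_hom_on A B f \<Longrightarrow> clinear_on A f"
  by (simp add: cd_hom_on_def clinear_on_def cscale_def)

lemma
  assumes "cvec.subspace A" "cvec.subspace B" "clinear_on A f" "clinear_on B g"
  shows tmap_pure: "a \<in> A \<Longrightarrow> b \<in> B \<Longrightarrow> tmap A B f g (a \<otimes> b) = f a \<otimes> g b"
    and tmap_add: "s \<in> tensor_sub A B \<Longrightarrow> t \<in> tensor_sub A B \<Longrightarrow>
      tmap A B f g (s + t) = tmap A B f g s + tmap A B f g t"
    and tmap_scale: "t \<in> tensor_sub A B \<Longrightarrow> tmap A B f g (tscale c t) = tscale c (tmap A B f g t)"
proof -
  have *: "bilinear_on A B cscale (\<lambda>a b. f a \<otimes> g b)"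
    using assms(3,4) by (simp add: bilinear_on_def clinear_on_def pure_add_left pure_add_right
        pure_cscale_left pure_cscale_right)
  show "a \<in> A \<Longrightarrow> b \<in> B \<Longrightarrow> tmap A B f g (a \<otimes> b) = f a \<otimes> g b"
    unfolding tmap_def by (rule tlift_pure[OF cvec.vector_space_axioms * assms(1,2)])
  show "s \<in> tensor_sub A B \<Longrightarrow> t \<in> tensor_sub A B \<Longrightarrow>
      tmap A B f g (s + t) = tmap A B f g s + tmap A B f g t"
    unfolding tmap_def by (rule tlift_linear(1)[OF cvec.vector_space_axioms * assms(1,2)])
  show "t \<in> tensor_sub A B \<Longrightarrow> tmap A B f g (tscale c t) = tscale c (tmap A B f g t)"
    unfolding tmap_def
    using tlift_linear(2)[OF cvec.vector_space_axioms * assms(1,2), of t t c] by simp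
qed

lemma tmap_zero:
  assumes "cvec.subspace A" "cvec.subspace B" "clinear_on A f" "clinear_on B g"
  shows "tmap A B f g 0 = 0"
  using tmap_add[OF assms, of 0 0] by simp

lemmas tmap_simps = tmap_zero tmap_pure tmap_add tmap_scale

lemma tmap_in_tensor_sub:
  assumes AB: "cvec.subspace A" "cvec.subspace B" "clinear_on A f" "clinear_on B g"
    and "t \<in> tensor_sub A B"
  shows "tmap A B f g t \<in> tensor_sub (f ` A) (g ` B)"
  using assms(5)
  by (induction rule: tensor_sub_induct)
    (simp_all add: tmap_simps[OF AB] tensor_sub_add tensor_sub_scale tensor_sub_pure)

text \<open>Functionals are pulled back along \<open>f\<close> and \<open>g\<close>. The pullbacks
  need to agree with the global functionals \<open>\<phi>'\<close> and \<open>\<psi>'\<close> on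
  \<open>A\<close> and \<open>B\<close> only, since \<open>f\<close> and \<open>g\<close> are linear
  only there; this is what a coproduct defined on a submodule requires.\<close>

lemma tensor_functional_tmap:
  assumes AB: "cvec.subspace A" "cvec.subspace B" "clinear_on A f" "clinear_on B g"
    and lin: "linear_functional \<phi>" "linear_functional \<psi>" "linear_functional \<phi>'" "linear_functional \<psi>'"
    and "\<And>a. a \<in> A \<Longrightarrow> \<phi> (f a) = \<phi>' a" "\<And>b. b \<in> B \<Longrightarrow> \<psi> (g b) = \<psi>' b"
    and "t \<in> tensor_sub A B"
  shows "tensor_functional \<phi> \<psi> (tmap A B f g t) = tensor_functional \<phi>' \<psi>' t"
  using assms(11)
  by (induction rule: tensor_sub_induct)
    (simp_all add: tmap_simps[OF AB] tensor_sub_scale tensor_sub_pure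
      tensor_functional_simps[OF lin(1,2)] tensor_functional_simps[OF lin(3,4)] assms(9,10))

lemma tswap_simps:
  fixes a :: "'a::cd_module" and b :: "'b::cd_module" and s t :: "('a, 'b) tensor"
  shows tswap_pure: "tswap (a \<otimes> b) = b \<otimes> a"
    and tswap_add: "tswap (s + t) = tswap s + tswap t"
    and tswap_scale: "tswap (tscale c t) = tscale c (tswap t)"
proof -
  have *: "bilinear_on UNIV UNIV cscale (\<lambda>(a::'a) (b::'b). b \<otimes> a)"
    by (simp add: bilinear_on_def pure_add_left pure_add_right pure_cscale_left pure_cscale_right)
  show "tswap (a \<otimes> b) = b \<otimes> a" "tswap (s + t) = tswap s + tswap t"
    "tswap (tscale c t) = tscale c (tswap t)"
    by (rule tlift_UNIV[OF cvec.vector_space_axioms *, folded tswap_def, unfolded cscale_tensor])+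
qed

lemma tswap_zero [simp]: "tswap 0 = 0"
  using tswap_add[of 0 0] by simp

lemma clinear_on_tswap: "clinear_on A tswap"
  by (simp add: clinear_on_def tswap_simps)

lemma tensor_functional_tswap:
  assumes "linear_functional \<phi>" "linear_functional \<psi>"
  shows "tensor_functional \<phi> \<psi> (tswap t) = tensor_functional \<psi> \<phi> t"
  by (induction t rule: tensor_induct)
    (simp_all add: tswap_simps tensor_functional_simps[OF assms] tensor_functional_simps[OF assms(2,1)])

lemma tassoc_simps:
  fixes a :: "'a::cd_module" and b :: "'b::cd_module" and c :: "'c::cd_module"
    and p q :: "('b, 'c) tensor" and s t :: "('a, ('b, 'c) tensor) tensor"
  shows tassoc_pure: "tassoc (a \<otimes> b \<otimes> c) = (a \<otimes> b) \<otimes> c"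
    and tassoc_pure_add: "tassoc (a \<otimes> (p + q)) = tassoc (a \<otimes> p) + tassoc (a \<otimes> q)"
    and tassoc_pure_scale: "tassoc (a \<otimes> tscale k p) = tscale k (tassoc (a \<otimes> p))"
    and tassoc_add: "tassoc (s + t) = tassoc s + tassoc t"
    and tassoc_scale: "tassoc (tscale k t) = tscale k (tassoc t)"
proof -
  define h :: "'a \<Rightarrow> ('b, 'c) tensor \<Rightarrow> (('a, 'b) tensor, 'c) tensor"
    where "h a = tlift UNIV UNIV cscale (\<lambda>b c. (a \<otimes> b) \<otimes> c)" for a
  have "bilinear_on UNIV UNIV cscale (\<lambda>(b :: 'b) (c :: 'c). (a \<otimes> b) \<otimes> c)" for a :: 'a
    by (simp add: bilinear_on_def pure_add_left pure_add_right pure_cscale_left pure_cscale_right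
        flip: cscale_tensor)
  note h = tlift_UNIV[OF cvec.vector_space_axioms this, folded h_def, unfolded cscale_tensor]
  have h0: "h a 0 = 0" for a using h(2)[of a 0 0] by simp
  \<comment> \<open>The outer lift is usable only once the inner one is linear in \<open>a\<close>
    as well; both sides are linear in \<open>p\<close>, so pure tensors decide.\<close>
  have "h (a + a') p = h a p + h a' p" for a a' p
    by (induction p rule: tensor_induct)
      (simp_all add: h h0 pure_add_left tvec.scale_right_distrib)
  moreover have "h (k *\<^sub>C a) p = tscale k (h a p)" for k a p
    by (induction p rule: tensor_induct)
      (simp_all add: h h0 pure_cscale_left tvec.scale_right_distrib mult.commute
        pure_cscale_left[of _ "_ \<otimes> _", unfolded cscale_tensor])
  ultimately have "bilinear_on UNIV UNIV cscale h"
    by (simp add: bilinear_on_def h)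
  note * = tlift_UNIV[OF cvec.vector_space_axioms this, unfolded h_def, folded tassoc_def, folded h_def,
      unfolded cscale_tensor]
  show "tassoc (a \<otimes> b \<otimes> c) = (a \<otimes> b) \<otimes> c"
    "tassoc (a \<otimes> (p + q)) = tassoc (a \<otimes> p) + tassoc (a \<otimes> q)"
    "tassoc (a \<otimes> tscale k p) = tscale k (tassoc (a \<otimes> p))"
    "tassoc (s + t) = tassoc s + tassoc t" "tassoc (tscale k t) = tscale k (tassoc t)"
    by (simp_all add: * h)
qed

lemma tensor_functional_tassoc:
  assumes "linear_functional \<phi>" "linear_functional \<psi>" "linear_functional \<chi>"
  shows "tensor_functional (tensor_functional \<phi> \<psi>) \<chi> (tassoc t) =
    tensor_functional \<phi> (tensor_functional \<psi> \<chi>) t"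
proof -
  note lin = assms linear_tensor_functional[OF assms(1,2)] linear_tensor_functional[OF assms(2,3)]
  note simps = tassoc_simps tensor_functional_simps[OF lin(1,2)] tensor_functional_simps[OF lin(2,3)]
    tensor_functional_simps[OF lin(4,3)] tensor_functional_simps[OF lin(1,5)]
  have zero: "tassoc 0 = 0" using tassoc_add[of 0 0] by simp
  \<comment> \<open>Pure tensors still have an arbitrary tensor \<open>p\<close> as right factor, so
    an induction on \<open>p\<close> precedes the one on \<open>t\<close>.\<close>
  have "tensor_functional (tensor_functional \<phi> \<psi>) \<chi> (tassoc (a \<otimes> p)) =
      \<phi> a * tensor_functional \<psi> \<chi> p" for a p
    by (induction p rule: tensor_induct) (simp_all add: simps zero algebra_simps)
  then show ?thesis
    by (induction t rule: tensor_induct) (simp_all add: simps zero)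
qed


section \<open>Evaluation of polynomials\<close>

lemma sum_upto_degree_extend:
  assumes "degree p \<le> N" "\<And>i. f i 0 = 0"
  shows "(\<Sum>i\<le>degree p. f i (coeff p i)) = (\<Sum>i\<le>N. f i (coeff p i))"
  using assms by (intro sum.mono_neutral_left) (auto simp: coeff_eq_0)

text \<open>Only additivity of the coefficient map is assumed. This covers evaluation in one
  variable, with the identity, and in two variables, with the inner evaluation as coefficient
  map.\<close>

locale psubst_eval = module act
  for act :: "'r::comm_ring_1 \<Rightarrow> 'n::ab_group_add \<Rightarrow> 'n" +
  fixes \<phi> :: "'m::ab_group_add \<Rightarrow> 'n" and q :: 'r
  assumes \<phi>_add: "\<phi> (x + y) = \<phi> x + \<phi> y"
begin

text \<open>Not a simplification rule: for \<open>\<phi> = id\<close> it is the looping rewrite rule \<open>0 = 0\<close>.\<close>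

lemma \<phi>_zero: "\<phi> 0 = 0"
  using \<phi>_add[of 0 0] by simp

lemma psubst_upto:
  assumes "degree p \<le> N"
  shows "psubst act q \<phi> p = (\<Sum>i\<le>N. act (q ^ i) (\<phi> (coeff p i)))"
  unfolding psubst_def using assms by (rule sum_upto_degree_extend) (simp add: \<phi>_zero)

lemma psubst_add: "psubst act q \<phi> (p + p') = psubst act q \<phi> p + psubst act q \<phi> p'"
proof -
  let ?N = "max (degree p) (degree p')"
  have "degree (p + p') \<le> ?N" by (rule degree_add_le_max)
  then show ?thesis
    by (simp add: psubst_upto[of _ ?N] \<phi>_add scale_right_distrib sum.distrib)
qed

lemma psubst_zero: "psubst act q \<phi> 0 = 0"
  by (simp add: psubst_def \<phi>_zero)

lemma psubst_uminus: "psubst act q \<phi> (- p) = - psubst act q \<phi> p"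
  by (rule minus_unique[symmetric]) (simp add: psubst_zero flip: psubst_add)

lemma psubst_sum: "psubst act q \<phi> (\<Sum>i\<in>I. f i) = (\<Sum>i\<in>I. psubst act q \<phi> (f i))"
  by (induction I rule: infinite_finite_induct) (simp_all add: psubst_add psubst_zero)

lemma psubst_monom: "psubst act q \<phi> (monom x i) = act (q ^ i) (\<phi> x)"
proof -
  have "psubst act q \<phi> (monom x i) = (\<Sum>j\<le>i. if j = i then act (q ^ i) (\<phi> x) else 0)"
    unfolding psubst_upto[OF degree_monom_le] by (rule sum.cong) (auto simp: \<phi>_zero)
  then show ?thesis by simp
qed

lemma psubst_const: "psubst act q \<phi> [:x:] = \<phi> x"
  by (simp add: psubst_def)

text \<open>Substitution turns multiplication by \<open>R\<close> into the action of the value of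
  \<open>R\<close> at \<open>q\<close>, where \<open>h\<close> translates scalars on the
  coefficients into scalars on the target.\<close>

lemma psubst_poly_act:
  assumes "\<And>r x. \<phi> (s r x) = act (h r) (\<phi> x)"
  shows "psubst act q \<phi> (poly_act s R p) =
    act (\<Sum>i\<le>degree R. h (coeff R i) * q ^ i) (psubst act q \<phi> p)"
proof -
  have "psubst act q \<phi> (poly_act s R p) =
      (\<Sum>i\<le>degree R. \<Sum>j\<le>degree p. act (h (coeff R i) * q ^ i) (act (q ^ j) (\<phi> (coeff p j))))"
    by (simp add: poly_act_def psubst_sum psubst_monom assms power_add ac_simps)
  then show ?thesis
    by (simp add: psubst_def[of act q \<phi> p] scale_sum_left scale_sum_right del: scale_scale)
      (rule sum.swap)
qed

end

text \<open>The number \<open>m\<close> enters as a constant polynomial in \<partial>, so that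
  substituting a number and substituting an expression in \<partial>, as in skew symmetry, are
  instances of one operation.\<close>

definition peval :: "complex \<Rightarrow> 'l poly \<Rightarrow> 'l::cd_module"
  where "peval m = psubst pscale [:m:] (\<lambda>x. x)"

text \<open>The inner variable \<open>\<lambda>\<close> is set to \<open>m\<close> and the outer variable \<open>\<mu>\<close> to \<open>n\<close>.\<close>

definition peval2 :: "complex \<Rightarrow> complex \<Rightarrow> 'l poly poly \<Rightarrow> 'l::cd_module"
  where "peval2 m n = psubst pscale [:n:] (peval m)"

interpretation peval: psubst_eval pscale "\<lambda>x. x" q for q
  by unfold_locales simp_all

interpretation peval2: psubst_eval pscale "peval m" q for m q
  by unfold_locales (simp add: peval_def peval.psubst_add)

lemma pconst_power: "[:c::'a::comm_ring_1:] ^ i = [:c ^ i:]"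
  by (induction i) simp_all

lemma peval_sum: "peval m p = (\<Sum>i\<le>degree p. m ^ i *\<^sub>C coeff p i)"
  by (simp add: peval_def psubst_def pconst_power cscale_def)

lemma peval_zero: "peval m 0 = 0"
  by (simp add: peval_sum)

lemma peval_act1: "peval m (act1 R p) = pscale (poly R [:m:]) (peval m p)"
  unfolding peval_def by (subst peval.psubst_poly_act[where h = "\<lambda>r. r"]) (simp_all add: poly_altdef)

text \<open>\<open>R\<close> has the variables \<mu>, \<lambda>, \<partial> from the outside in: the
  inner \<open>poly\<close> sets \<mu> to \<open>n\<close>, the outer one sets \<lambda> to
  \<open>m\<close>, and a polynomial in \<partial> remains to act.\<close>

lemma peval2_act2:
  "peval2 m n (act2 R p) = pscale (poly (poly R [:[:n:]:]) [:m:]) (peval2 m n p)"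
proof -
  have "(\<Sum>i\<le>degree R. poly (coeff R i) [:m:] * [:n:] ^ i) = poly (poly R [:[:n:]:]) [:m:]"
    by (simp add: poly_altdef[of R] poly_sum)
  then show ?thesis
    unfolding peval2_def
    by (subst peval2.psubst_poly_act[where h = "\<lambda>r. poly r [:m:]"]) (simp_all add: peval_act1)
qed

text \<open>Evaluation is additive and respects the ring action, so it passes through the powers of
  \<open>q\<close> and only the value of \<open>q\<close>, a polynomial in \<partial>, is
  substituted.\<close>

lemma peval_psubst_act1:
  fixes \<phi> :: "'a::zero \<Rightarrow> 'b::cd_module poly"
  shows
  "peval m (psubst act1 q \<phi> p) = psubst pscale (poly q [:m:]) (\<lambda>x. peval m (\<phi> x)) p"
proof -
  have sum: "peval m (\<Sum>i\<in>I. f i) = (\<Sum>i\<in>I. peval m (f i))"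
    for I :: "nat set" and f :: "nat \<Rightarrow> 'b poly"
    by (simp add: peval_def peval.psubst_sum)
  show ?thesis
    by (simp add: psubst_def sum peval_act1)
qed

lemma peval2_psubst_act2:
  fixes \<phi> :: "'a::zero \<Rightarrow> 'b::cd_module poly poly"
  shows
  "peval2 m n (psubst act2 q \<phi> p) =
    psubst pscale (poly (poly q [:[:n:]:]) [:m:]) (\<lambda>x. peval2 m n (\<phi> x)) p"
proof -
  have sum: "peval2 m n (\<Sum>i\<in>I. f i) = (\<Sum>i\<in>I. peval2 m n (f i))"
    for I :: "nat set" and f :: "nat \<Rightarrow> 'b poly poly"
    by (simp add: peval2_def peval2.psubst_sum)
  show ?thesis
    by (simp add: psubst_def sum peval2_act2)
qed

lemma peval2_bracket_at:
  assumes "poly (poly q [:[:n:]:]) [:m:] = [:k:]"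
  shows "peval2 m n (bracket_at br q a b) = peval k (br a b)"
proof -
  have "peval2 m n [:[:x:]:] = x" for x :: 'a
    by (simp add: peval2_def peval2.psubst_const) (simp add: peval_def peval.psubst_const)
  then show ?thesis
    by (simp add: bracket_at_def peval2_psubst_act2 assms) (simp add: peval_def)
qed

section \<open>Linearity of the elements of the conformal dual\<close>

lemma
  shows cdual_apply_add [simp]: "cdual_apply f (x + y) = cdual_apply f x + cdual_apply f y"
    and cdual_apply_scale [simp]: "cdual_apply f (c *\<^sub>C x) = smult c (cdual_apply f x)"
  using cdual_apply[of f] unfolding linear_cscale_smult_iff mem_Collect_eq by blast+

lemma cdual_apply_partial [simp]: "cdual_apply f (\<partial> x) = [:0, 1:] * cdual_apply f x"
  using cdual_apply[of f] unfolding mem_Collect_eq by blast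

lemma cdual_apply_zero [simp]: "cdual_apply f 0 = 0"
  using cdual_apply_add[of f 0 0] by (simp only: add_0_right add_cancel_right_right)

lemma cdual_apply_sum: "cdual_apply f (\<Sum>i\<in>I. g i) = (\<Sum>i\<in>I. cdual_apply f (g i))"
  by (induction I rule: infinite_finite_induct) simp_all

lemma cdual_apply_uminus: "cdual_apply f (- x) = - cdual_apply f x"
  by (rule minus_unique[symmetric]) (simp flip: cdual_apply_add)

lemma cdual_apply_pscale: "cdual_apply f (pscale p x) = p * cdual_apply f x"
proof (induction p)
  case 0
  show ?case by simp
next
  case (pCons c p)
  have "pscale (pCons c p) x = c *\<^sub>C x + \<partial> (pscale p x)"
    by (simp add: cscale_def cpartial_def pscale_pscale flip: pscale_left_distrib)
  then show ?case by (simp add: pCons)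
qed


section \<open>Point evaluations on the conformal dual\<close>

definition cdual_ev :: "'l::cd_module \<Rightarrow> complex \<Rightarrow> 'l cdual \<Rightarrow> complex"
  where "cdual_ev a x f = poly (cdual_apply f a) x"

lemma cdual_apply_cscale: "cdual_apply (c *\<^sub>C f) u = smult c (cdual_apply f u)"
  by (simp add: cscale_def pscale_cdual.rep_eq pcompose_pCons)

lemma linear_cdual_ev: "linear_functional (cdual_ev a x)"
  by (simp add: linear_functional_def cdual_ev_def plus_cdual.rep_eq cdual_apply_cscale)

lemma cdual_ev_pscale: "cdual_ev a x (pscale p f) = poly p (- x) * cdual_ev a x f"
  by (simp add: cdual_ev_def pscale_cdual.rep_eq poly_pcompose)

lemma cdual_ev_add_left: "cdual_ev (a + b) x f = cdual_ev a x f + cdual_ev b x f"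
  by (simp add: cdual_ev_def)

lemma separating_cdual_ev: "separating {cdual_ev a x | a x. True}"
  unfolding separating_def
proof (intro conjI ballI allI impI)
  fix f :: "'a cdual"
  assume "\<forall>\<phi>\<in>{cdual_ev a x | a x. True}. \<phi> f = 0"
  then have "cdual_ev a x f = 0" for a x
    by blast
  then have "poly (cdual_apply f a) x = 0" for a x
    by (simp add: cdual_ev_def)
  then have "cdual_apply f = (\<lambda>_. 0)"
    using poly_all_0_iff_0 by blast
  then show "f = 0"
    by (simp add: zero_cdual.rep_eq flip: cdual_apply_inject)
qed (use linear_cdual_ev in blast)

lemma tensor_cdual_eqI:
  fixes s t :: "('a::cd_module cdual, 'b::cd_module cdual) tensor"
  assumes "\<And>a b u v. tensor_functional (cdual_ev a u) (cdual_ev b v) s =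
    tensor_functional (cdual_ev a u) (cdual_ev b v) t"
  shows "s = t"
  by (rule separatingD[OF separating_tensor[OF separating_cdual_ev separating_cdual_ev]])
    (use assms in blast)

lemma tensor3_cdual_eqI:
  fixes s t :: "(('a::cd_module cdual, 'b::cd_module cdual) tensor, 'c::cd_module cdual) tensor"
  assumes "\<And>a b c u v w.
    tensor_functional (tensor_functional (cdual_ev a u) (cdual_ev b v)) (cdual_ev c w) s =
    tensor_functional (tensor_functional (cdual_ev a u) (cdual_ev b v)) (cdual_ev c w) t"
  shows "s = t"
  by (rule separatingD[OF separating_tensor[OF separating_tensor[OF separating_cdual_ev separating_cdual_ev]
        separating_cdual_ev]])
    (use assms in blast)

text \<open>A nonzero polynomial over the domain of polynomials in \<lambda> has finitely many
  roots, whereas \<open>p - q\<close> vanishes at all the infinitely many constants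
  \<open>[:m:]\<close>.\<close>

lemma poly_poly_eqI:
  fixes p q :: "complex poly poly"
  assumes "\<And>m x. poly (poly p [:m:]) x = poly (poly q [:m:]) x"
  shows "p = q"
proof (rule ccontr)
  assume "p \<noteq> q"
  then have "finite {z. poly (p - q) z = 0}"
    by (intro poly_roots_finite) simp
  moreover have "poly (p - q) [:m:] = 0" for m
    using assms by (intro iffD1[OF poly_all_0_iff_0]) simp
  ultimately have "finite (range (\<lambda>m::complex. [:m:]))"
    by (auto elim: finite_subset[rotated])
  then show False
    using infinite_UNIV_char_0[where 'a = complex] by (simp add: finite_image_iff inj_def)
qed

text \<open>By linearity, \<open>f\<close> can be applied after the evaluation at \<open>m\<close>
  instead of coefficientwise. As \<open>f\<close> may kill leading coefficients, the sum is first
  extended to the degree of \<open>p\<close>.\<close>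

lemma poly_map_poly_cdual_apply:
  "poly (poly (map_poly (cdual_apply f) p) [:m:]) x = cdual_ev (peval m p) x f"
proof -
  have "degree (map_poly (cdual_apply f) p) \<le> degree p"
    by (rule map_poly_degree_leq)
  then have "poly (map_poly (cdual_apply f) p) [:m:] =
      (\<Sum>i\<le>degree p. coeff (map_poly (cdual_apply f) p) i * [:m:] ^ i)"
    unfolding poly_altdef by (rule sum_upto_degree_extend) simp
  then show ?thesis
    by (simp add: coeff_map_poly poly_sum pconst_power peval_sum cdual_ev_def cdual_apply_sum mult.commute)
qed

text \<open>Under \<open>f\<close> evaluated at \<open>x\<close>, the operator \<partial> acts as
  the number \<open>x\<close>. Hence the substitution of \<open>- m - \<partial>\<close> in the skew
  symmetry axiom becomes evaluation at \<open>- m - x\<close>.\<close>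

lemma cdual_ev_peval_skew:
  assumes "lie_conformal_algebra br"
  shows "cdual_ev (peval m (br a b)) x f = - cdual_ev (peval (- m - x) (br b a)) x f"
proof -
  interpret lie_conformal_algebra br by fact
  have "peval m (br a b) =
      - psubst pscale (- [:m:] - [:0, 1:]) (\<lambda>x. x) (br b a)"
  proof -
    have "peval m (br a b) = - peval m (psubst act1 (- lambda1 - partial1) (\<lambda>x. [:x:]) (br b a))"
      by (subst skew) (simp add: peval_def peval.psubst_uminus)
    then show ?thesis
      by (simp add: peval_psubst_act1) (simp add: peval_def peval.psubst_const)
  qed
  also have "cdual_ev \<dots> x f = - (\<Sum>i\<le>degree (br b a). (- m - x) ^ i * cdual_ev (coeff (br b a) i) x f)"
    by (simp add: cdual_ev_def psubst_def cdual_apply_uminus cdual_apply_sum cdual_apply_pscale poly_sum)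
  also have "\<dots> = - cdual_ev (peval (- m - x) (br b a)) x f"
    by (simp add: peval_sum cdual_ev_def cdual_apply_sum poly_sum)
  finally show ?thesis .
qed

section \<open>The bracket and the Jacobi identity at complex parameters\<close>

context lie_conformal_algebra
begin

lemma peval_br_right: "peval m (br a (x + y)) = peval m (br a x) + peval m (br a y)"
  and peval_br_left: "peval m (br (x + y) a) = peval m (br x a) + peval m (br y a)"
  by (simp_all add: add_left add_right peval_def peval.psubst_add)

lemma peval_map_poly_cscale: "peval m (map_poly (cscale c) p) = c *\<^sub>C peval m p"
proof -
  have "peval m (map_poly (cscale c) p) = (\<Sum>i\<le>degree p. m ^ i *\<^sub>C coeff (map_poly (cscale c) p) i)"
    unfolding peval_sum by (rule sum_upto_degree_extend) (simp_all add: map_poly_degree_leq)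
  then show ?thesis
    by (simp add: coeff_map_poly peval_sum cvec.scale_sum_right mult.commute)
qed

lemma peval_br_sum_right:
  "peval m (br a (\<Sum>i\<in>I. k i *\<^sub>C g i)) = (\<Sum>i\<in>I. k i *\<^sub>C peval m (br a (g i)))"
proof -
  have 0: "br a 0 = 0" using add_right[of a 0 0] by simp
  show ?thesis
    by (induction I rule: infinite_finite_induct)
      (simp_all add: peval_br_right scale_right peval_map_poly_cscale 0 peval_zero)
qed

lemma peval_br_sum_left:
  "peval m (br (\<Sum>i\<in>I. k i *\<^sub>C g i) a) = (\<Sum>i\<in>I. k i *\<^sub>C peval m (br (g i) a))"
proof -
  have 0: "br 0 a = 0" using add_left[of 0 0 a] by simp
  show ?thesis
    by (induction I rule: infinite_finite_induct)
      (simp_all add: peval_br_left scale_left peval_map_poly_cscale 0 peval_zero)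
qed

text \<open>The axiom is evaluated at \<lambda> = \<open>m\<close> and \<mu> = \<open>n\<close>. The
  inner brackets become finite linear combinations of their coefficients, and linearity of the outer
  bracket collects them again.\<close>

lemma peval_jacobi:
  "peval m (br a (peval n (br b c))) =
    peval (m + n) (br (peval m (br a b)) c) + peval n (br b (peval m (br a c)))"
proof -
  \<comment> \<open>At a constant, substitution is a complex linear combination, to which the
    \<open>peval_br_sum\<close> lemmas apply.\<close>
  have lin: "psubst pscale [:k:] h p = (\<Sum>i\<le>degree p. k ^ i *\<^sub>C h (coeff p i))"
    for k and h :: "'l \<Rightarrow> 'l" and p
    by (simp add: psubst_def pconst_power cscale_def)
  have add2: "peval2 m n (p + q) = peval2 m n p + peval2 m n q" for p q :: "'l poly poly"
    by (simp add: peval2_def peval2.psubst_add)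
  have "peval2 m n (psubst act2 mu2 (\<lambda>x. bracket_at br lambda2 a x) (br b c)) =
      peval2 m n (psubst act2 lambda2 (\<lambda>x. bracket_at br (lambda2 + mu2) x c) (br a b) +
      psubst act2 lambda2 (\<lambda>x. bracket_at br mu2 b x) (br a c))"
    by (rule arg_cong[OF jacobi])
  then show ?thesis
    by (simp add: add2 peval2_psubst_act2 peval2_bracket_at[of _ n m m] peval2_bracket_at[of _ n m n]
        peval2_bracket_at[of _ n m "m + n"] lin peval_sum[of _ "br b c"]
        peval_sum[of _ "br a b"] peval_sum[of _ "br a c"] peval_br_sum_right peval_br_sum_left)
qed

end


section \<open>The coproduct on a good submodule\<close>

lemma poly_cdual_at:
  "poly (poly (cdual_at f q a) [:m:]) x = cdual_ev a (poly (poly q [:m:]) x) f"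
proof -
  have "poly (poly (poly (map_poly (\<lambda>c. [:[:c:]:]) p) q) [:m:]) x = poly p (poly (poly q [:m:]) x)" for p
    by (induction p) (simp_all add: map_poly_pCons)
  then show ?thesis
    by (simp add: cdual_at_def cdual_ev_def)
qed

lemma cdual_at_simps:
  "cdual_at (f + g) q a = cdual_at f q a + cdual_at g q a"
  "cdual_at (c *\<^sub>C f) q a = cscale2 c (cdual_at f q a)"
  "cdual_at f q (a + b) = cdual_at f q a + cdual_at f q b"
  "cdual_at f q (c *\<^sub>C a) = cscale2 c (cdual_at f q a)"
  by (rule poly_poly_eqI,
      simp add: poly_cdual_at linear_functionalD[OF linear_cdual_ev] cdual_ev_add_left; simp add: cdual_ev_def)+

lemma vector_space_cscale2: "vector_space cscale2"
proof
  show "cscale2 (a + b) x = cscale2 a x + cscale2 b x" for a b x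
    using smult_add_left[of "[:a:]" "[:b:]" x] by simp
qed (simp_all add: smult_add_right mult.commute flip: one_pCons)

lemma Phi_simps:
  fixes f g :: "'l::cd_module cdual" and s t :: "('l cdual, 'l cdual) tensor" and x y :: "('l, 'l) tensor"
  shows Phi_pure: "Phi q (f \<otimes> g) (a \<otimes> b) = cdual_at f q a * cdual_at g (lambda2 - q) b"
    and Phi_add: "Phi q (s + t) x = Phi q s x + Phi q t x"
    and Phi_scale: "Phi q (tscale c t) x = cscale2 c (Phi q t x)"
    and Phi_add_right: "Phi q t (x + y) = Phi q t x + Phi q t y"
    and Phi_scale_right: "Phi q t (tscale c x) = cscale2 c (Phi q t x)"
proof -
  \<comment> \<open>\<open>Phi\<close> is a nested lift: with \<open>x\<close> fixed, the inner lift
    must be bilinear in \<open>f\<close> and \<open>g\<close> before the outer one can be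
    computed.\<close>
  define h where
    "h = (\<lambda>x (f::'l cdual) (g::'l cdual). tlift UNIV UNIV cscale2 (\<lambda>a b. cdual_at f q a * cdual_at g (lambda2 - q) b) x)"
  have "bilinear_on UNIV UNIV cscale2 (\<lambda>a b. cdual_at f q a * cdual_at g (lambda2 - q) b)"
    for f g :: "'l cdual"
    by (simp add: bilinear_on_def cdual_at_simps algebra_simps)
  note h = tlift_UNIV[OF vector_space_cscale2 this]
  have h': "h (a \<otimes> b) f g = cdual_at f q a * cdual_at g (lambda2 - q) b"
    "h (x + y) f g = h x f g + h y f g" "h (tscale c x) f g = cscale2 c (h x f g)"
    for a b f g x y c
    by (simp_all add: h_def h)
  have h0: "h 0 f g = 0" for f g using h'(2)[of 0 0 f g] by simp
  have "h x (f + f') g = h x f g + h x f' g" "h x f (g + g') = h x f g + h x f g'"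
    "h x (c *\<^sub>C f) g = cscale2 c (h x f g)" "h x f (c *\<^sub>C g) = cscale2 c (h x f g)" for x f f' g g' c
    by (induction x rule: tensor_induct; simp add: h0 h' cdual_at_simps algebra_simps smult_add_right)+
  then have "bilinear_on UNIV UNIV cscale2 (h x)" for x
    by (simp add: bilinear_on_def)
  note * = tlift_UNIV[OF vector_space_cscale2 this]
  have Phi: "Phi q t x = tlift UNIV UNIV cscale2 (h x) t" for t x
    by (simp add: Phi_def h_def)
  show add: "Phi q (s + t) x = Phi q s x + Phi q t x" for s t and x :: "('l, 'l) tensor"
    by (simp add: Phi *)
  show scale: "Phi q (tscale c t) x = cscale2 c (Phi q t x)" for c t and x :: "('l, 'l) tensor"
    by (simp add: Phi *)
  show "Phi q (f \<otimes> g) (a \<otimes> b) = cdual_at f q a * cdual_at g (lambda2 - q) b"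
    by (simp add: Phi * h')
  have zero: "Phi q 0 x = 0" for x :: "('l, 'l) tensor" using add[of 0 0 x] by simp
  have pure': "Phi q (f \<otimes> g) x = h x f g" for f g x by (simp add: Phi *)
  show "Phi q t (x + y) = Phi q t x + Phi q t y"
    by (induction t rule: tensor_induct) (simp_all add: zero add scale pure' h' smult_add_right)
  show "Phi q t (tscale c x) = cscale2 c (Phi q t x)"
    by (induction t rule: tensor_induct) (simp_all add: zero add scale pure' h' smult_add_right mult.commute)
qed

text \<open>At \<mu> = \<open>m\<close> and \<lambda> = \<open>x\<close> the two subscripts
  \<open>- \<mu>\<close> and \<open>\<lambda> - (- \<mu>)\<close> become \<open>- m\<close> and
  \<open>x + m\<close>.\<close>

lemma poly_Phi_pure:
  "poly (poly (Phi (- mu2) t (a \<otimes> b)) [:m:]) x =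
    tensor_functional (cdual_ev a (- m)) (cdual_ev b (x + m)) t"
proof (induction t rule: tensor_induct)
  case zero
  have "Phi (- mu2) 0 (a \<otimes> b) = 0" using Phi_add[of "- mu2" 0 0 "a \<otimes> b"] by simp
  then show ?case
    by (simp add: linear_functionalD(3)[OF linear_tensor_functional] linear_cdual_ev)
next
  case (step c f g t)
  then show ?case
    by (simp add: Phi_simps tensor_functional_simps linear_cdual_ev poly_cdual_at add.commute)
qed

text \<open>This is the defining equation of \<delta> at complex points, in the coordinates
  \<open>u\<close> = \<open>- \<mu>\<close> and \<open>v\<close> = \<open>\<lambda> + \<mu>\<close>;
  so \<mu> = \<open>- u\<close> and \<lambda> = \<open>u + v\<close>. No submodule is mentioned,
  which makes coproducts taken in different submodules comparable.\<close>

definition is_coproduct ::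
    "('l \<Rightarrow> 'l \<Rightarrow> 'l poly) \<Rightarrow> 'l::cd_module cdual \<Rightarrow> ('l cdual, 'l cdual) tensor \<Rightarrow> bool"
  where "is_coproduct br f t \<longleftrightarrow>
    (\<forall>a b u v. tensor_functional (cdual_ev a u) (cdual_ev b v) t =
      cdual_ev (peval (- u) (br a b)) (u + v) f)"

lemma is_coproductD:
  "is_coproduct br f t \<Longrightarrow> tensor_functional (cdual_ev a u) (cdual_ev b v) t =
    cdual_ev (peval (- u) (br a b)) (u + v) f"
  by (simp add: is_coproduct_def)

lemma is_coproduct_unique: "is_coproduct br f s \<Longrightarrow> is_coproduct br f t \<Longrightarrow> s = t"
  by (rule tensor_cdual_eqI) (simp add: is_coproductD)

lemma is_coproduct_zero: "is_coproduct br 0 0"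
  by (simp add: is_coproduct_def linear_functionalD(3)[OF linear_tensor_functional]
      linear_functionalD(3)[OF linear_cdual_ev] linear_cdual_ev)

lemma is_coproduct_add:
  "is_coproduct br f s \<Longrightarrow> is_coproduct br g t \<Longrightarrow> is_coproduct br (f + g) (s + t)"
  by (simp add: is_coproduct_def tensor_functional_simps(1) linear_functionalD(1)[OF linear_cdual_ev] linear_cdual_ev)

text \<open>By the Leibniz rule \<partial> contributes \<open>- u\<close> from the left factor and
  \<open>- v\<close> from the right one. The sum \<open>- (u + v)\<close> is how \<partial> acts
  under the evaluation of \<open>f\<close> at \<open>u + v\<close>.\<close>

lemma tensor_functional_cdual_ev_pscale:
  "tensor_functional (cdual_ev a u) (cdual_ev b v) (pscale p t) =
    poly p (- (u + v)) * tensor_functional (cdual_ev a u) (cdual_ev b v) t"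
proof -
  note simps = tensor_functional_simps[OF linear_cdual_ev linear_cdual_ev]
  have partial: "tensor_functional (cdual_ev a u) (cdual_ev b v) (tensor_partial t) =
      - (u + v) * tensor_functional (cdual_ev a u) (cdual_ev b v) t" for t
    by (induction t rule: tensor_induct)
      (simp_all add: simps tensor_partial cdual_ev_pscale cpartial_def algebra_simps)
  show ?thesis
    by (induction p)
      (simp_all add: pscale_tensor_0 pscale_tensor_pCons simps partial algebra_simps)
qed

lemma is_coproduct_pscale: "is_coproduct br f t \<Longrightarrow> is_coproduct br (pscale p f) (pscale p t)"
  by (simp add: is_coproduct_def tensor_functional_cdual_ev_pscale cdual_ev_pscale)

text \<open>Both sides are linear in the tensor argument and have polynomial values, so pure tensors
  and complex points decide.\<close>

lemma Phi_eq_Pi_mu_iff: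
  fixes br :: "'l::cd_module \<Rightarrow> 'l \<Rightarrow> 'l poly"
  assumes "lie_conformal_algebra br"
  shows "Phi (- mu2) t = Pi_mu br f \<longleftrightarrow> is_coproduct br f t"
proof -
  interpret lie_conformal_algebra br by fact
  \<comment> \<open>Bilinearity is checked on values, where applying \<open>f\<close>
    coefficientwise becomes \<open>cdual_ev\<close> at an evaluated bracket.\<close>
  have "bilinear_on UNIV UNIV cscale2 (\<lambda>a b. map_poly (cdual_apply f) (br a b))"
    unfolding bilinear_on_def
    by (auto intro!: poly_poly_eqI simp: poly_map_poly_cdual_apply peval_br_left peval_br_right
        scale_left scale_right peval_map_poly_cscale cdual_ev_add_left) (simp_all add: cdual_ev_def)
  note Pi = tlift_UNIV[OF vector_space_cscale2 this, folded Pi_mu_def]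
  have poly_Pi: "poly (poly (Pi_mu br f (a \<otimes> b)) [:m:]) x = cdual_ev (peval m (br a b)) x f" for a b m x
    by (simp add: Pi poly_map_poly_cdual_apply)
  show ?thesis
  proof
    assume *: "Phi (- mu2) t = Pi_mu br f"
    show "is_coproduct br f t"
      unfolding is_coproduct_def
    proof (intro allI)
      fix a b u v
      show "tensor_functional (cdual_ev a u) (cdual_ev b v) t = cdual_ev (peval (- u) (br a b)) (u + v) f"
        \<comment> \<open>These values of \<open>m\<close> and \<open>x\<close> solve
          \<open>- m = u\<close> and \<open>x + m = v\<close>, so every pair of evaluation points is
          reached.\<close>
        using poly_Phi_pure[of t a b "- u" "u + v", unfolded *] by (simp add: poly_Pi)
    qed
  next
    assume *: "is_coproduct br f t"
    have pure: "Phi (- mu2) t (a \<otimes> b) = Pi_mu br f (a \<otimes> b)" for a b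
      by (rule poly_poly_eqI, unfold poly_Phi_pure poly_Pi is_coproductD[OF *]) simp
    have zero: "Phi (- mu2) t 0 = 0" "Pi_mu br f 0 = 0"
      using Phi_add_right[of "- mu2" t 0 0] Pi(2)[of 0 0] by simp_all
    show "Phi (- mu2) t = Pi_mu br f"
    proof
      fix x :: "('l, 'l) tensor"
      show "Phi (- mu2) t x = Pi_mu br f x"
        by (induction x rule: tensor_induct) (simp_all only: Phi_simps(4,5) Pi(2,3) pure zero)
    qed
  qed
qed

lemma good_iff:
  assumes "lie_conformal_algebra br"
  shows "good br V \<longleftrightarrow> cd.subspace V \<and> (\<forall>f\<in>V. \<exists>t\<in>tensor_sub V V. is_coproduct br f t)"
proof -
  have "Pi_mu br f \<in> Phi (- mu2) ` tensor_sub V V \<longleftrightarrow> (\<exists>t\<in>tensor_sub V V. is_coproduct br f t)" for f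
    unfolding Phi_eq_Pi_mu_iff[OF assms, symmetric] image_iff by metis
  then show ?thesis
    unfolding good_def image_subset_iff by simp
qed

text \<open>Goodness gives existence. Uniqueness comes from \<open>is_coproduct_unique\<close>, the
  pointwise form of the injectivity of \<open>Phi (- mu2)\<close>, so the description in
  \<open>delta\<close> denotes.\<close>

lemma
  assumes "lie_conformal_algebra br" "good br V" "f \<in> V"
  shows delta_in_tensor_sub: "delta br V f \<in> tensor_sub V V"
    and is_coproduct_delta: "is_coproduct br f (delta br V f)"
proof -
  have "\<exists>!t. t \<in> tensor_sub V V \<and> is_coproduct br f t"
    using assms is_coproduct_unique unfolding good_iff[OF assms(1)] by blast
  from theI'[OF this] show "delta br V f \<in> tensor_sub V V" "is_coproduct br f (delta br V f)"
    unfolding delta_def Phi_eq_Pi_mu_iff[OF assms(1)] by blast+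
qed

section \<open>The coalgebra axioms for \<open>delta\<close>\<close>

lemma cvec_subspace: "cd.subspace V \<Longrightarrow> cvec.subspace V"
  by (simp add: cd.subspace_def cvec.subspace_def cscale_def)

text \<open>Sums and multiples of coproducts are coproducts of the corresponding elements, so
  uniqueness forces \<delta> to be linear over the polynomials in \<partial>.\<close>

lemma cd_hom_on_delta:
  assumes "lie_conformal_algebra br" "good br V"
  shows "cd_hom_on V (tensor_sub V V) (delta br V)"
proof -
  have V: "cd.subspace V" using assms(2) by (simp add: good_def)
  note is_coproduct_delta = is_coproduct_delta[OF assms]
  show ?thesis
    unfolding cd_hom_on_def
  proof (intro conjI ballI allI)
    show "delta br V \<in> V \<rightarrow> tensor_sub V V"
      using delta_in_tensor_sub[OF assms] by blast
    show "delta br V (x + y) = delta br V x + delta br V y" if "x \<in> V" "y \<in> V" for x y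
      using that V by (intro is_coproduct_unique[of br "x + y"] is_coproduct_delta is_coproduct_add cd.subspace_add)
    show "delta br V (pscale p x) = pscale p (delta br V x)" if "x \<in> V" for x p
      using that V by (intro is_coproduct_unique[of br "pscale p x"] is_coproduct_delta is_coproduct_pscale
          cd.subspace_scale)
  qed
qed

lemma good_imp_diff_lie_coalgebra:
  fixes br :: "'l::cd_module \<Rightarrow> 'l \<Rightarrow> 'l poly"
  assumes br: "lie_conformal_algebra br" and V: "good br V"
  shows "diff_lie_coalgebra V (delta br V)"
proof -
  interpret lie_conformal_algebra br by fact
  let ?\<delta> = "delta br V"
  have sub: "cd.subspace V" using V by (simp add: good_def)
  note cop = is_coproductD[OF is_coproduct_delta[OF br V]]
  note lin = linear_cdual_ev linear_tensor_functional
  note tmap = tensor_functional_tmap[OF cvec_subspace[OF sub] cvec_subspace[OF sub] _ _ _ _ _ _ _ _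
      delta_in_tensor_sub[OF br V]]
  note \<delta> = cd_hom_on_imp_clinear_on[OF cd_hom_on_delta[OF br V]]
  have "tswap (?\<delta> f) = - ?\<delta> f" if "f \<in> V" for f
  proof (rule tensor_cdual_eqI)
    fix a b u v
    show "tensor_functional (cdual_ev a u) (cdual_ev b v) (tswap (?\<delta> f)) =
        tensor_functional (cdual_ev a u) (cdual_ev b v) (- ?\<delta> f)"
      \<comment> \<open>Swapping exchanges \<open>(a, u)\<close> with \<open>(b, v)\<close> and
        leads to the bracket of \<open>b\<close> and \<open>a\<close> at \<open>- v\<close>, which
        equals \<open>- m - x\<close> for \<open>m = - u\<close> and
        \<open>x = u + v\<close>.\<close>
      using cdual_ev_peval_skew[OF br, of "- u" a b "u + v" f] that
      by (simp add: tensor_functional_tswap tensor_functional_simps lin cop add.commute)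
  qed
  moreover have "tassoc (tmap V V id ?\<delta> (?\<delta> f)) - tmap UNIV UNIV tswap id (tassoc (tmap V V id ?\<delta> (?\<delta> f))) =
      tmap V V ?\<delta> id (?\<delta> f)" if f: "f \<in> V" for f
  proof (rule tensor3_cdual_eqI)
    fix a b c :: 'l and u v w
    let ?y = "tassoc (tmap V V id ?\<delta> (?\<delta> f))"
    let ?E = "\<lambda>a u b v. tensor_functional (tensor_functional (cdual_ev a u) (cdual_ev b v)) (cdual_ev c w)"
    \<comment> \<open>Evaluating the inner coproduct at \<open>(b, v)\<close> and
      \<open>(c, w)\<close> is again a point evaluation, at the bracket of \<open>b\<close> and
      \<open>c\<close> and the point \<open>v + w\<close>; so the coproduct formula applies a second
      time.\<close>
    have y: "?E a u b v ?y = cdual_ev (peval (- u) (br a (peval (- v) (br b c)))) (u + v + w) f" for a b u v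
    proof -
      have "?E a u b v ?y = tensor_functional (cdual_ev a u) (cdual_ev (peval (- v) (br b c)) (v + w)) (?\<delta> f)"
        unfolding tensor_functional_tassoc[OF lin(1) lin(1) lin(1)]
        by (rule tmap) (simp_all add: f cop \<delta> clinear_on_id lin)
      then show ?thesis
        by (simp add: cop f add.assoc)
    qed
    \<comment> \<open>The swap in the first two factors exchanges \<open>(a, u)\<close> and
      \<open>(b, v)\<close>, which yields the second iterated bracket of the Jacobi
      identity.\<close>
    have "?E a u b v (tmap UNIV UNIV tswap id ?y) = ?E b v a u ?y"
      by (rule tensor_functional_tmap) (simp_all add: tensor_functional_tswap clinear_on_tswap clinear_on_id lin)
    moreover have "?E a u b v (tmap V V ?\<delta> id (?\<delta> f)) =
        tensor_functional (cdual_ev (peval (- u) (br a b)) (u + v)) (cdual_ev c w) (?\<delta> f)"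
      by (rule tmap) (simp_all add: f cop \<delta> clinear_on_id lin)
    \<comment> \<open>All three terms are values of \<open>f\<close> at \<open>u + v + w\<close>;
      Jacobi at the parameters \<open>- u\<close> and \<open>- v\<close> relates their arguments,
      the outer bracket on the right being taken at \<open>- (u + v)\<close>.\<close>
    ultimately show "?E a u b v (?y - tmap UNIV UNIV tswap id ?y) = ?E a u b v (tmap V V ?\<delta> id (?\<delta> f))"
      using peval_jacobi[of "- u" a "- v" b c]
      by (simp add: tensor_functional_simps lin y cop f cdual_ev_add_left add.commute[of v u])
  qed
  ultimately show ?thesis
    using sub cd_hom_on_delta[OF br V] by (simp add: diff_lie_coalgebra_def Let_def)
qed

section \<open>The maximal good submodule\<close>

lemma good_L0:
  assumes br: "lie_conformal_algebra br"
  shows "good br (L0 br)"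
  unfolding good_iff[OF br]
proof (intro conjI ballI)
  show "cd.subspace (L0 br)"
    unfolding L0_def by (rule cd.subspace_span)
  fix f assume "f \<in> L0 br"
  then show "\<exists>t\<in>tensor_sub (L0 br) (L0 br). is_coproduct br f t"
    unfolding L0_def
  proof (induction rule: cd.span_induct_alt)
    case base
    show ?case using is_coproduct_zero by (intro bexI[of _ 0]) simp_all
  next
    case (step c x y)
    then obtain t V where V: "good br V" "x \<in> V"
      and t: "t \<in> tensor_sub (L0 br) (L0 br)" "is_coproduct br y t"
      unfolding L0_def by blast
    \<comment> \<open>The multiple stays in the single good submodule \<open>V\<close>, so only a
      sum has to be formed across different submodules.\<close>
    have "pscale c x \<in> V"
      using V by (auto simp: good_def cd.subspace_scale)
    then obtain s where s: "s \<in> tensor_sub V V" "is_coproduct br (pscale c x) s"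
      using V br by (auto simp: good_iff)
    have "V \<subseteq> L0 br"
      using V unfolding L0_def by (auto intro: cd.span_base)
    then have "s \<in> tensor_sub (L0 br) (L0 br)"
      using s(1) tensor_sub_mono by blast
    with t s(2) show ?case
      unfolding L0_def[symmetric] by (intro bexI[of _ "s + t"] is_coproduct_add tensor_sub_add)
  qed
qed

lemma good_subset_L0: "good br V \<Longrightarrow> V \<subseteq> L0 br"
  unfolding L0_def by (auto intro: cd.span_base)


section \<open>Functoriality\<close>

lemma cdual_ev_dual_map:
  "module_hom pscale pscale F \<Longrightarrow> cdual_ev a x (dual_map F f) = cdual_ev (F a) x f"
  by (simp add: cdual_ev_def cdual_apply_dual_map)

text \<open>Point evaluations separate, and on them \<open>dual_map F\<close> merely replaces
  \<open>a\<close> by \<open>F a\<close>.\<close>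

lemma module_hom_dual_map:
  assumes "module_hom pscale pscale F"
  shows "module_hom pscale pscale (dual_map F)"
proof
  show "dual_map F (f + g) = dual_map F f + dual_map F g" for f g
    by (rule separatingD[OF separating_cdual_ev])
      (auto simp: cdual_ev_dual_map[OF assms] linear_functionalD(1)[OF linear_cdual_ev])
  show "dual_map F (pscale p f) = pscale p (dual_map F f)" for p f
    by (rule separatingD[OF separating_cdual_ev])
      (auto simp: cdual_ev_dual_map[OF assms] cdual_ev_pscale)
qed

lemma peval_lie_conformal_hom:
  assumes "lie_conformal_hom br1 br2 F"
  shows "peval m (br2 (F a) (F b)) = F (peval m (br1 a b))"
proof -
  interpret module_hom pscale pscale F
    using assms by (simp add: lie_conformal_hom_def)
  have "degree (map_poly F (br1 a b)) \<le> degree (br1 a b)"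
    by (rule map_poly_degree_leq)
  then have "peval m (map_poly F (br1 a b)) = (\<Sum>i\<le>degree (br1 a b). m ^ i *\<^sub>C F (coeff (br1 a b) i))"
    unfolding peval_sum by (subst sum_upto_degree_extend) (simp_all add: coeff_map_poly)
  then show ?thesis
    using assms by (simp add: lie_conformal_hom_def peval_sum sum scale cscale_def)
qed

text \<open>Evaluating the image of \<open>t\<close> at \<open>(a, u)\<close> and
  \<open>(b, v)\<close> is evaluating \<open>t\<close> at \<open>(F a, u)\<close> and
  \<open>(F b, v)\<close>; then \<open>F\<close> is pulled out of the bracket. The separate map
  \<open>g\<close> lets the lemma serve both \<open>dual_map F\<close> and its restriction
  \<open>dual_map0\<close>, which agrees with it only on \<open>L0 br2\<close>.\<close>

lemma is_coproduct_tmap_dual_map: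
  assumes F: "lie_conformal_hom br1 br2 F"
    and V: "cvec.subspace V" and t: "t \<in> tensor_sub V V" "is_coproduct br2 f t"
    and g: "clinear_on V g" "\<And>x. x \<in> V \<Longrightarrow> g x = dual_map F x"
  shows "is_coproduct br1 (dual_map F f) (tmap V V g g t)"
  unfolding is_coproduct_def
proof (intro allI)
  fix a b u v
  have hom: "module_hom pscale pscale F"
    using F by (simp add: lie_conformal_hom_def)
  have "tensor_functional (cdual_ev a u) (cdual_ev b v) (tmap V V g g t) =
      tensor_functional (cdual_ev (F a) u) (cdual_ev (F b) v) t"
    by (rule tensor_functional_tmap) (simp_all add: V t g linear_cdual_ev cdual_ev_dual_map[OF hom])
  then show "tensor_functional (cdual_ev a u) (cdual_ev b v) (tmap V V g g t) =
      cdual_ev (peval (- u) (br1 a b)) (u + v) (dual_map F f)"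
    by (simp add: is_coproductD[OF t(2)] cdual_ev_dual_map[OF hom] peval_lie_conformal_hom[OF F])
qed

lemma good_dual_map:
  assumes br: "lie_conformal_algebra br1" "lie_conformal_algebra br2"
    and F: "lie_conformal_hom br1 br2 F" and V: "good br2 V"
  shows "good br1 (dual_map F ` V)"
  unfolding good_iff[OF br(1)]
proof (intro conjI ballI)
  interpret dual: module_hom pscale pscale "dual_map F"
    using F by (simp add: lie_conformal_hom_def module_hom_dual_map)
  have sub: "cd.subspace V"
    using V by (simp add: good_def)
  then show "cd.subspace (dual_map F ` V)"
    by (rule dual.subspace_image)
  have clin: "clinear_on V (dual_map F)"
    by (simp add: clinear_on_def dual.add dual.scale cscale_def)
  fix f assume "f \<in> dual_map F ` V"
  then obtain g where g: "g \<in> V" "f = dual_map F g" by blast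
  then obtain t where t: "t \<in> tensor_sub V V" "is_coproduct br2 g t"
    using V by (auto simp: good_iff[OF br(2)])
  \<comment> \<open>The witness is the image of \<open>t\<close> under \<open>dual_map F\<close> on
    both factors.\<close>
  show "\<exists>s\<in>tensor_sub (dual_map F ` V) (dual_map F ` V). is_coproduct br1 f s"
    unfolding g(2)
    using is_coproduct_tmap_dual_map[OF F cvec_subspace[OF sub] t clin]
      tmap_in_tensor_sub[OF cvec_subspace[OF sub] cvec_subspace[OF sub] clin clin t(1)] by blast
qed

lemma dual_map_L0_subset:
  assumes "lie_conformal_algebra br1" "lie_conformal_algebra br2" "lie_conformal_hom br1 br2 F"
  shows "dual_map F ` L0 br2 \<subseteq> L0 br1"
  using good_dual_map[OF assms good_L0[OF assms(2)]] by (rule good_subset_L0)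

text \<open>For each \<open>f\<close> in \<open>L0 br2\<close>, both sides of the compatibility
  equation are coproducts of \<open>dual_map F f\<close> for \<open>br1\<close>, so uniqueness
  identifies them.\<close>

lemma diff_lie_coalgebra_hom_dual_map0:
  assumes br: "lie_conformal_algebra br1" "lie_conformal_algebra br2"
    and F: "lie_conformal_hom br1 br2 F"
  shows "diff_lie_coalgebra_hom (L0 br2) (delta br2 (L0 br2)) (L0 br1) (delta br1 (L0 br1)) (dual_map0 br2 F)"
proof -
  interpret dual: module_hom pscale pscale "dual_map F"
    using F by (simp add: lie_conformal_hom_def module_hom_dual_map)
  note good1 = good_L0[OF br(1)] and good2 = good_L0[OF br(2)]
  have sub: "cd.subspace (L0 br2)"
    using good2 by (simp add: good_def)
  have F0: "dual_map0 br2 F f = dual_map F f" if "f \<in> L0 br2" for f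
    using that by (simp add: dual_map0_def)
  have mem: "dual_map F f \<in> L0 br1" if "f \<in> L0 br2" for f
    using dual_map_L0_subset[OF br F] that by blast
  have hom: "cd_hom_on (L0 br2) (L0 br1) (dual_map0 br2 F)"
    by (simp add: cd_hom_on_def F0 mem dual.add dual.scale cd.subspace_add[OF sub] cd.subspace_scale[OF sub])
  have "delta br1 (L0 br1) (dual_map0 br2 F f) =
      tmap (L0 br2) (L0 br2) (dual_map0 br2 F) (dual_map0 br2 F) (delta br2 (L0 br2) f)"
    if f: "f \<in> L0 br2" for f
    unfolding F0[OF f]
    by (rule is_coproduct_unique[OF is_coproduct_delta[OF br(1) good1 mem[OF f]]
        is_coproduct_tmap_dual_map[OF F cvec_subspace[OF sub] delta_in_tensor_sub[OF br(2) good2 f]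
          is_coproduct_delta[OF br(2) good2 f] cd_hom_on_imp_clinear_on[OF hom] F0]])
  with hom show ?thesis
    by (simp add: diff_lie_coalgebra_hom_def)
qed

theorem proposition3p3:
  shows "(\<forall>br :: 'l::cd_module \<Rightarrow> 'l \<Rightarrow> 'l poly. lie_conformal_algebra br \<longrightarrow>
      (\<forall>V. good br V \<longrightarrow> diff_lie_coalgebra V (delta br V)) \<and>
      diff_lie_coalgebra (L0 br) (delta br (L0 br)))
    \<and>
    (\<forall>(br1 :: 'm::cd_module \<Rightarrow> 'm \<Rightarrow> 'm poly) (br2 :: 'n::cd_module \<Rightarrow> 'n \<Rightarrow> 'n poly) F.
      lie_conformal_algebra br1 \<longrightarrow> lie_conformal_algebra br2 \<longrightarrow> lie_conformal_hom br1 br2 F \<longrightarrow>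
      (\<forall>V. good br2 V \<longrightarrow> good br1 (dual_map F ` V)) \<and>
      dual_map F ` L0 br2 \<subseteq> L0 br1 \<and>
      diff_lie_coalgebra_hom (L0 br2) (delta br2 (L0 br2)) (L0 br1) (delta br1 (L0 br1))
        (dual_map0 br2 F))"
  by (intro conjI allI impI good_imp_diff_lie_coalgebra good_L0 good_dual_map dual_map_L0_subset
      diff_lie_coalgebra_hom_dual_map0)

end
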